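(* Let $F,f,h_1,\dots,h_p\colon\mathbb R^n\times\mathbb R^m\to\mathbb R$ be continuously differentiable, $X\subset\mathbb R^n$ closed, $I=\{1,\dots,\ell\}$, $J=\{\ell+1,\dots,p\}$, $\Gamma(x):=\{y\mid h_i(x,y)\le0\ (i\in I),\ h_i(x,y)=0\ (i\in J)\}$, $\varphi(x):=\inf\{f(x,y)\mid y\in\Gamma(x)\}$, $S(x):=\operatorname{argmin}\{f(x,y)\mid y\in\Gamma(x)\}$, $h_0(x,y):=f(x,y)-\varphi(x)$. Let $(\bar x,\bar y)$ be a local minimizer of the problem $\min_{x,y}\{F(x,y)\mid x\in X,\ y\in S(x)\}$ (BPP'). Assume one of the following: (a) (A1'): for each $x$, $f(x,\cdot)$ and $h_i(x,\cdot)$, $i\in I$, are convex and $h_i(x,\cdot)$, $i\in J$, are affine; (A2): $\Gamma$ is locally bounded at $\bar x$; and RCPLD$_S$ with respect to $\operatorname{dom}\Gamma$ holds at each point of $\{\bar x\}\times S(\bar x)$; (b) $S$ is inner semicontinuous at $(\bar x,\bar y)$ with respect to $\operatorname{dom}\Gamma$ and RCPLD$_S$ with respect to $\operatorname{dom}\Gamma$ holds at $(\bar x,\bar y)$. Then (BPP') is partially calm at $(\bar x,\bar y)$.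
   Context: $\operatorname{dom}\Gamma:=\{x\mid\Gamma(x)\neq\emptyset\}$; $\inf\emptyset=+\infty$. (BPP') is partially calm at its local minimizer $(\bar x,\bar y)$ if there exist a neighborhood $U$ of $(\bar x,\bar y,0)$ and $\kappa>0$ such that $F(x,y)-F(\bar x,\bar y)+\kappa|u|\ge0$ for all $(x,y,u)\in U$ with $x\in X$, $f(x,y)-\varphi(x)\le u$, $y\in\Gamma(x)$. $\Gamma$ is locally bounded at $\bar x$ if there are a bounded $B$ and a neighborhood $V$ of $\bar x$ with $\Gamma(x)\subset B$ for $x\in V$. $S$ is inner semicontinuous at $(\bar x,\bar y)$ with respect to $\Omega$ if for every $\{x^k\}\subset\Omega$, $x^k\to\bar x$, there is $y^k\to\bar y$ with $y^k\in S(x^k)$ for large $k$. A pair of finite families $((a^i)_{i\in I_1},(b^i)_{i\in I_2})$ is positive-linearly dependent if there are $\alpha_i\ge0$, $\beta_i$, not all zero, with $\sum\alpha_ia^i+\sum\beta_ib^i=0$. For $(\hat x,\hat y)\in\operatorname{gph}S$ let $I(\hat x,\hat y):=\{i\in I\mid h_i(\hat x,\hat y)=0\}$ and $\nabla_yh_0:=\nabla_yf$. RCPLD$_S$ holds at $(\hat x,\hat y)$ with respect to $\Omega$ if there are a neighborhood $U$ of $(\hat x,\hat y)$ and $\mathcal S\subset J$ such that: (i) $\{\nabla_yh_i(\hat x,\hat y)\mid i\in\mathcal S\}$ is a basis of the span of $\{\nabla_yh_i(\hat x,\hat y)\mid i\in J\}$; (ii) $(\nabla_yh_i(x,y))_{i\in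 J}$ has constant rank on $U\cap(\Omega\times\mathbb R^m)$; (iii) for each $K\subset\{0\}\cup I(\hat x,\hat y)$ with $((\nabla_yh_i(\hat x,\hat y))_{i\in K},(\nabla_yh_i(\hat x,\hat y))_{i\in\mathcal S})$ positive-linearly dependent, $(\nabla_yh_i(x,y))_{i\in K\cup\mathcal S}$ is linearly dependent for each $(x,y)\in U\cap(\Omega\times\mathbb R^m)$. *)

theory Defs
  imports "HOL-Analysis.Analysis"
begin

definition C1_fun :: "('a::real_normed_vector \<Rightarrow> real) \<Rightarrow> bool" where
  "C1_fun g \<longleftrightarrow> (\<exists>g'. (\<forall>z. (g has_derivative blinfun_apply (g' z)) (at z)) \<and> continuous_on UNIV g')"

definition grad_y :: "('x \<Rightarrow> real^'m \<Rightarrow> real) \<Rightarrow> 'x \<Rightarrow> real^'m \<Rightarrow> real^'m" where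
  "grad_y g x y = (\<chi> j. frechet_derivative (g x) (at y) (axis j 1))"

definition Gam :: "nat \<Rightarrow> nat \<Rightarrow> (nat \<Rightarrow> 'x \<Rightarrow> 'y \<Rightarrow> real) \<Rightarrow> 'x \<Rightarrow> 'y set" where
  "Gam l p h x = {y. (\<forall>i\<in>{1..l}. h i x y \<le> 0) \<and> (\<forall>i\<in>{l+1..p}. h i x y = 0)}"

definition phi :: "nat \<Rightarrow> nat \<Rightarrow> ('x \<Rightarrow> 'y \<Rightarrow> real) \<Rightarrow> (nat \<Rightarrow> 'x \<Rightarrow> 'y \<Rightarrow> real) \<Rightarrow> 'x \<Rightarrow> ereal" where
  "phi l p f h x = (INF y\<in>Gam l p h x. ereal (f x y))"

definition Sol :: "nat \<Rightarrow> nat \<Rightarrow> ('x \<Rightarrow> 'y \<Rightarrow> real) \<Rightarrow> (nat \<Rightarrow> 'x \<Rightarrow> 'y \<Rightarrow> real) \<Rightarrow> 'x \<Rightarrow> 'y set" where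
  "Sol l p f h x = {y \<in> Gam l p h x. \<forall>y'\<in>Gam l p h x. f x y \<le> f x y'}"

definition domGam :: "nat \<Rightarrow> nat \<Rightarrow> (nat \<Rightarrow> 'x \<Rightarrow> 'y \<Rightarrow> real) \<Rightarrow> 'x set" where
  "domGam l p h = {x. Gam l p h x \<noteq> {}}"

definition lin_dep_fam :: "'i set \<Rightarrow> ('i \<Rightarrow> 'v::real_vector) \<Rightarrow> bool" where
  "lin_dep_fam K v \<longleftrightarrow> (\<exists>c. (\<exists>i\<in>K. c i \<noteq> 0) \<and> (\<Sum>i\<in>K. c i *\<^sub>R v i) = 0)"

definition pos_lin_dep :: "'i set \<Rightarrow> ('i \<Rightarrow> 'v::real_vector) \<Rightarrow> 'j set \<Rightarrow> ('j \<Rightarrow> 'v) \<Rightarrow> bool" where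
  "pos_lin_dep K1 a K2 b \<longleftrightarrow> (\<exists>\<alpha> \<beta>. (\<forall>i\<in>K1. \<alpha> i \<ge> 0) \<and> ((\<exists>i\<in>K1. \<alpha> i \<noteq> 0) \<or> (\<exists>i\<in>K2. \<beta> i \<noteq> 0))
      \<and> (\<Sum>i\<in>K1. \<alpha> i *\<^sub>R a i) + (\<Sum>i\<in>K2. \<beta> i *\<^sub>R b i) = 0)"

definition rank_fam :: "'i set \<Rightarrow> ('i \<Rightarrow> 'v::euclidean_space) \<Rightarrow> nat" where
  "rank_fam K v = dim (span (v ` K))"

text \<open>h_0 := f (only its y-gradient is used, grad_y h_0 = grad_y f).\<close>
definition hh :: "('x \<Rightarrow> 'y \<Rightarrow> real) \<Rightarrow> (nat \<Rightarrow> 'x \<Rightarrow> 'y \<Rightarrow> real) \<Rightarrow> nat \<Rightarrow> 'x \<Rightarrow> 'y \<Rightarrow> real" where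
  "hh f h i = (if i = 0 then f else h i)"

definition active :: "nat \<Rightarrow> (nat \<Rightarrow> 'x \<Rightarrow> 'y \<Rightarrow> real) \<Rightarrow> 'x \<Rightarrow> 'y \<Rightarrow> nat set" where
  "active l h x y = {i \<in> {1..l}. h i x y = 0}"

definition RCPLD_S :: "nat \<Rightarrow> nat \<Rightarrow> ('x::euclidean_space \<Rightarrow> real^'m \<Rightarrow> real) \<Rightarrow> (nat \<Rightarrow> 'x \<Rightarrow> real^'m \<Rightarrow> real)
    \<Rightarrow> 'x set \<Rightarrow> 'x \<Rightarrow> real^'m \<Rightarrow> bool" where
  "RCPLD_S l p f h \<Omega> xh yh \<longleftrightarrow>
    (let J = {l+1..p}; g = (\<lambda>x y i. grad_y (hh f h i) x y) in
     \<exists>U \<S>. open U \<and> (xh, yh) \<in> U \<and> \<S> \<subseteq> J \<and>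
       \<not> lin_dep_fam \<S> (g xh yh) \<and> span (g xh yh ` \<S>) = span (g xh yh ` J) \<and>
       (\<forall>x y x' y'. (x, y) \<in> U \<and> x \<in> \<Omega> \<and> (x', y') \<in> U \<and> x' \<in> \<Omega> \<longrightarrow>
            rank_fam J (g x y) = rank_fam J (g x' y')) \<and>
       (\<forall>K. K \<subseteq> {0} \<union> active l h xh yh \<and> pos_lin_dep K (g xh yh) \<S> (g xh yh) \<longrightarrow>
            (\<forall>x y. (x, y) \<in> U \<and> x \<in> \<Omega> \<longrightarrow> lin_dep_fam (K \<union> \<S>) (g x y))))"

definition local_min_BPP :: "nat \<Rightarrow> nat \<Rightarrow> ('x::topological_space \<Rightarrow> 'y::topological_space \<Rightarrow> real) \<Rightarrow> ('x \<Rightarrow> 'y \<Rightarrow> real)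
    \<Rightarrow> (nat \<Rightarrow> 'x \<Rightarrow> 'y \<Rightarrow> real) \<Rightarrow> 'x set \<Rightarrow> 'x \<Rightarrow> 'y \<Rightarrow> bool" where
  "local_min_BPP l p F f h X xb yb \<longleftrightarrow> xb \<in> X \<and> yb \<in> Sol l p f h xb \<and>
     (\<exists>V. open V \<and> (xb, yb) \<in> V \<and>
        (\<forall>x y. (x, y) \<in> V \<and> x \<in> X \<and> y \<in> Sol l p f h x \<longrightarrow> F xb yb \<le> F x y))"

definition partially_calm :: "nat \<Rightarrow> nat \<Rightarrow> ('x::topological_space \<Rightarrow> 'y::topological_space \<Rightarrow> real) \<Rightarrow> ('x \<Rightarrow> 'y \<Rightarrow> real)
    \<Rightarrow> (nat \<Rightarrow> 'x \<Rightarrow> 'y \<Rightarrow> real) \<Rightarrow> 'x set \<Rightarrow> 'x \<Rightarrow> 'y \<Rightarrow> bool" where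
  "partially_calm l p F f h X xb yb \<longleftrightarrow>
     (\<exists>U \<kappa>. open U \<and> (xb, yb, 0::real) \<in> U \<and> \<kappa> > 0 \<and>
        (\<forall>x y u. (x, y, u) \<in> U \<and> x \<in> X \<and> ereal (f x y) - phi l p f h x \<le> ereal u \<and> y \<in> Gam l p h x
           \<longrightarrow> F x y - F xb yb + \<kappa> * \<bar>u\<bar> \<ge> 0))"

definition locally_bounded_at :: "('x::topological_space \<Rightarrow> 'y::metric_space set) \<Rightarrow> 'x \<Rightarrow> bool" where
  "locally_bounded_at G xb \<longleftrightarrow> (\<exists>B V. bounded B \<and> open V \<and> xb \<in> V \<and> (\<forall>x\<in>V. G x \<subseteq> B))"

definition inner_semicont_wrt :: "('x::topological_space \<Rightarrow> 'y::topological_space set) \<Rightarrow> 'x set \<Rightarrow> 'x \<Rightarrow> 'y \<Rightarrow> bool" where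
  "inner_semicont_wrt S \<Omega> xb yb \<longleftrightarrow>
     (\<forall>xk. (\<forall>k. xk k \<in> \<Omega>) \<and> xk \<longlonglongrightarrow> xb \<longrightarrow>
        (\<exists>yk. yk \<longlonglongrightarrow> yb \<and> (\<forall>\<^sub>F k in sequentially. yk k \<in> S (xk k))))"

end

theory Submission
  imports Defs
begin

text \<open>The value-function constraint is exact for penalization because of the local error bound
\<^emph>\<open>dist y (S x) \<le> C (f x y - \<phi> x)\<close> for feasible y near the reference point: a feasible pair can be
repaired into a bilevel-feasible one at a cost proportional to u, and F is locally Lipschitz.

For the error bound let z be the projection of y onto S x. Quadratic penalization yields a point w
arbitrarily close to z at which (y - w) + (z - w) is a combination of constraint gradients, with
nonnegative coefficients on inequalities active at z. Constant rank lets the equality gradients be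
replaced by the basis, and a conic Caratheodory reduction makes the remaining family linearly
independent at w; by RCPLD it is then positive-linearly independent at the reference point, so the
multipliers are bounded uniformly by a multiple of the norm of y - z. Pairing with y - z and
linearizing gives the bound. No constraint qualification is ever applied at z itself.\<close>

section \<open>Calculus and penalization\<close>

text \<open>The joint derivative is composed with the embedding of the second factor, so the
  components of \<open>grad_y\<close> are its values at \<open>(0, axis j 1)\<close>; continuity in
  both variables together is inherited from there.\<close>

lemma C1_fun_partial:
  fixes G :: "'a::real_normed_vector \<Rightarrow> real^'m \<Rightarrow> real"
  assumes "C1_fun (\<lambda>z. G (fst z) (snd z))"
  shows C1_fun_has_derivative_grad_y: "(G x has_derivative (\<lambda>v. grad_y G x y \<bullet> v)) (at y)"
    and C1_fun_continuous_grad_y: "continuous_on UNIV (\<lambda>z. grad_y G (fst z) (snd z))"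
    and C1_fun_continuous: "continuous_on UNIV (\<lambda>z. G (fst z) (snd z))"
proof -
  obtain g' where g': "\<And>z. ((\<lambda>z. G (fst z) (snd z)) has_derivative blinfun_apply (g' z)) (at z)"
    and cont: "continuous_on UNIV g'"
    using assms unfolding C1_fun_def by blast
  have D: "(G x has_derivative (\<lambda>v. g' (x, y) (0, v))) (at y)" for x y
  proof -
    have "((\<lambda>y. (x, y)) has_derivative (\<lambda>v. (0, v))) (at y)"
      by (auto intro!: derivative_eq_intros)
    from has_derivative_compose[OF this, of "\<lambda>z. G (fst z) (snd z)"] g'
    show ?thesis by auto
  qed
  have grad: "grad_y G x y = (\<chi> j. g' (x, y) (0, axis j 1))" for x y
    unfolding grad_y_def using frechet_derivative_at[OF D[of x y]] by (simp add: fun_eq_iff)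
  have "grad_y G x y \<bullet> v = g' (x, y) (0, v)" for v
  proof -
    have lin: "linear (\<lambda>v. g' (x, y) (0, v))"
      using has_derivative_linear[OF D] .
    have "g' (x, y) (0, v) = g' (x, y) (0, \<Sum>j\<in>UNIV. v $ j *\<^sub>R axis j 1)"
      using basis_expansion[of v] by (simp add: scalar_mult_eq_scaleR)
    also have "\<dots> = (\<Sum>j\<in>UNIV. v $ j * g' (x, y) (0, axis j 1))"
      using linear_sum[OF lin, of "\<lambda>j. v $ j *\<^sub>R axis j 1" UNIV] linear_cmul[OF lin] by simp
    finally show ?thesis unfolding grad inner_vec_def by (simp add: mult.commute)
  qed
  with D[of x y] show "(G x has_derivative (\<lambda>v. grad_y G x y \<bullet> v)) (at y)" by simp
  have "continuous_on UNIV (\<lambda>z. \<chi> j. g' z (0, axis j 1))"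
    by (intro continuous_intros cont)
  then show "continuous_on UNIV (\<lambda>z. grad_y G (fst z) (snd z))"
    by (simp add: grad)
  show "continuous_on UNIV (\<lambda>z. G (fst z) (snd z))"
    by (intro continuous_at_imp_continuous_on ballI has_derivative_continuous[OF g'])
qed

text \<open>The gradient is taken at a third point \<open>w\<close>, because multipliers will be
  known there while increments run from \<open>z\<close> to \<open>y\<close>. On a small convex ball
  the gradient varies by at most \<open>\<epsilon>\<close>, and the mean value inequality gives the
  estimate uniformly in \<open>x\<close>.\<close>

lemma C1_fun_linearization:
  fixes G :: "'a::real_normed_vector \<Rightarrow> real^'m \<Rightarrow> real"
  assumes C1: "C1_fun (\<lambda>z. G (fst z) (snd z))" and "\<epsilon> > 0"
  shows "\<exists>\<delta>>0. \<forall>x y z w. dist x x0 < \<delta> \<and> dist y y0 < \<delta> \<and> dist z y0 < \<delta> \<and> dist w y0 < \<delta> \<longrightarrow>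
           \<bar>G x y - G x z - grad_y G x w \<bullet> (y - z)\<bar> \<le> \<epsilon> * dist y z"
proof -
  have "isCont (\<lambda>z. grad_y G (fst z) (snd z)) (x0, y0)"
    using C1_fun_continuous_grad_y[OF C1] by (simp add: continuous_on_eq_continuous_at)
  then obtain d where d: "d > 0"
    "\<And>z. dist z (x0, y0) < d \<Longrightarrow> dist (grad_y G (fst z) (snd z)) (grad_y G x0 y0) < \<epsilon> / 2"
    using \<open>\<epsilon> > 0\<close> unfolding continuous_at_eps_delta by (metis fst_conv half_gt_zero snd_conv)
  have near: "dist (grad_y G x y) (grad_y G x0 y0) < \<epsilon> / 2"
    if "dist x x0 < d / 2" "dist y y0 < d / 2" for x y
  proof -
    have "dist (x, y) (x0, y0) \<le> dist x x0 + dist y y0"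
      unfolding dist_Pair_Pair by (rule sqrt_sum_squares_le_sum) auto
    with that d(2)[of "(x, y)"] show ?thesis by simp
  qed
  have "\<bar>G x y - G x z - grad_y G x w \<bullet> (y - z)\<bar> \<le> \<epsilon> * dist y z"
    if x: "dist x x0 < d / 2" and "dist y y0 < d / 2" "dist z y0 < d / 2" "dist w y0 < d / 2" for x y z w
  proof -
    let ?B = "ball y0 (d / 2)"
    have in_B: "y \<in> ?B" "z \<in> ?B" "w \<in> ?B" using that by (auto simp: dist_commute)
    have "norm (G x y - G x z - grad_y G x w \<bullet> (y - z)) \<le> norm (y - z) * \<epsilon>"
    proof (rule differentiable_bound_linearization[where S = ?B and f' = "\<lambda>u v. grad_y G x u \<bullet> v"])
      show "z + t *\<^sub>R (y - z) \<in> ?B" if "t \<in> {0..1}" for t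
        using convexD_alt[OF convex_ball in_B(2,1), of t] that by (simp add: algebra_simps)
      show "(G x has_derivative (\<bullet>) (grad_y G x u)) (at u within ?B)" for u
        using C1_fun_has_derivative_grad_y[OF C1] has_derivative_at_withinI by blast
      show "onorm ((\<lambda>v. grad_y G x u \<bullet> v) - (\<lambda>v. grad_y G x w \<bullet> v)) \<le> \<epsilon>" if "u \<in> ?B" for u
        unfolding fun_diff_def
      proof (rule onorm_bound)
        fix v
        have "dist (grad_y G x u) (grad_y G x w) \<le> \<epsilon>"
          using near[OF x, of u] near[OF x, of w] that in_B(3)
            dist_triangle_half_r[of "grad_y G x0 y0" "grad_y G x u" \<epsilon> "grad_y G x w"]
          by (simp add: dist_commute)
        then have "norm (grad_y G x u - grad_y G x w) \<le> \<epsilon>" by (simp add: dist_norm)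
        then show "norm (grad_y G x u \<bullet> v - grad_y G x w \<bullet> v) \<le> \<epsilon> * norm v"
          unfolding inner_diff_left[symmetric] real_norm_def
          by (meson Cauchy_Schwarz_ineq2 mult_right_mono norm_ge_zero order_trans)
      qed (use \<open>\<epsilon> > 0\<close> in simp)
    qed (use in_B in auto)
    then show ?thesis by (simp add: dist_norm mult.commute)
  qed
  then show ?thesis using d(1) by (meson half_gt_zero)
qed

text \<open>An exact multiplier rule at \<open>z\<close> would need a constraint qualification. A
  penalized minimizer inside a ball is an unconstrained local minimizer, so stationarity at a nearby
  \<open>w\<close> comes for free. Each multiplier is penalty weight times violation, whence the
  signs on \<open>A\<close> and the positivity of \<open>G i w\<close> wherever such a multiplier is
  nonzero.\<close>

lemma approximate_multipliers_of_projection: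
  fixes G :: "'i \<Rightarrow> 'v::euclidean_space \<Rightarrow> real"
  assumes fin: "finite A" "finite B" and disj: "A \<inter> B = {}"
    and deriv: "\<And>i w. i \<in> A \<union> B \<Longrightarrow> (G i has_derivative (\<lambda>v. D i w \<bullet> v)) (at w)"
    and z: "\<forall>i\<in>A. G i z \<le> 0" "\<forall>i\<in>B. G i z = 0"
    and nearest: "\<And>w. \<forall>i\<in>A. G i w \<le> 0 \<Longrightarrow> \<forall>i\<in>B. G i w = 0 \<Longrightarrow> dist y z \<le> dist y w"
    and "\<epsilon> > 0"
  obtains w \<mu> where "dist w z < \<epsilon>" "\<And>i. i \<in> A \<Longrightarrow> \<mu> i \<ge> 0" "\<And>i. i \<in> A \<Longrightarrow> \<mu> i \<noteq> 0 \<Longrightarrow> G i w > 0"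
    "(\<Sum>i\<in>A \<union> B. \<mu> i *\<^sub>R D i w) = (y - w) + (z - w)"
proof -
  \<comment> \<open>The summand \<open>norm (w - z)\<close> in the objective makes z the unique solution, forcing the penalized
    minimizers to converge to z.\<close>
  define viol where "viol i w = (if i \<in> A then max 0 (G i w) else G i w)" for i w
  define pen where "pen w = (\<Sum>i\<in>A \<union> B. (viol i w)\<^sup>2)" for w
  define obj where "obj w = (norm (w - y))\<^sup>2 + (norm (w - z))\<^sup>2" for w
  define P where "P n w = obj w + real n * pen w" for n w
  have contG: "continuous_on UNIV (G i)" if "i \<in> A \<union> B" for i
    by (intro continuous_at_imp_continuous_on ballI has_derivative_continuous[OF deriv[OF that]])
  have cont_viol: "continuous_on UNIV (viol i)" if "i \<in> A \<union> B" for i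
    using contG[OF that] unfolding viol_def by (cases "i \<in> A") (auto intro!: continuous_intros)
  have cont_pen: "continuous_on UNIV pen"
    unfolding pen_def by (intro continuous_intros cont_viol)
  have cont_obj: "continuous_on UNIV obj"
    unfolding obj_def by (intro continuous_intros)
  have pen_nonneg: "pen w \<ge> 0" for w unfolding pen_def by (simp add: sum_nonneg)
  have pen_z: "pen z = 0" unfolding pen_def viol_def using z by (auto intro!: sum.neutral)
  \<comment> \<open>Compactness of the ball supplies minimizers; they may lie on its boundary until
    convergence to \<open>z\<close> along a subsequence is known.\<close>
  have "\<exists>w \<in> cball z (\<epsilon>/2). \<forall>w'\<in>cball z (\<epsilon>/2). P n w \<le> P n w'" for n
    unfolding P_def using \<open>\<epsilon> > 0\<close>
    by (intro continuous_attains_inf continuous_intros continuous_on_subset[OF cont_pen]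
        continuous_on_subset[OF cont_obj]) auto
  then obtain W where W: "\<And>n. W n \<in> cball z (\<epsilon>/2)"
    and Wmin: "\<And>n w'. w' \<in> cball z (\<epsilon>/2) \<Longrightarrow> P n (W n) \<le> P n w'"
    by metis
  obtain w0 r where r: "strict_mono r" and lim: "(W \<circ> r) \<longlonglongrightarrow> w0"
    using compact_cball[of z "\<epsilon>/2"] W unfolding compact_def by metis
  \<comment> \<open>Comparison with \<open>z\<close>, where the penalty and the second summand of
    \<open>obj\<close> both vanish.\<close>
  have PW: "obj (W n) + real n * pen (W n) \<le> (norm (z - y))\<^sup>2" for n
    using Wmin[of z n] \<open>\<epsilon> > 0\<close> unfolding P_def by (simp add: pen_z) (simp add: obj_def)
  have lim_obj: "(\<lambda>n. obj (W (r n))) \<longlonglongrightarrow> obj w0" and lim_pen: "(\<lambda>n. pen (W (r n))) \<longlonglongrightarrow> pen w0"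
    using cont_obj cont_pen lim by (auto simp: continuous_on_eq_continuous_at comp_def intro: isCont_tendsto_compose)
  have "pen (W (r n)) \<le> (norm (z - y))\<^sup>2 / real n" if "n > 0" for n
  proof -
    have "real n * pen (W (r n)) \<le> real (r n) * pen (W (r n))"
      using seq_suble[OF r, of n] pen_nonneg by (simp add: mult_right_mono)
    also have "\<dots> \<le> (norm (z - y))\<^sup>2" using PW[of "r n"] unfolding obj_def by (smt (verit) zero_le_power2)
    finally show ?thesis using that by (simp add: field_simps)
  qed
  moreover have "(\<lambda>n. (norm (z - y))\<^sup>2 / real n) \<longlonglongrightarrow> 0"
    by (rule lim_const_over_n)
  ultimately have "pen w0 \<le> 0"
    by (intro LIMSEQ_le[OF lim_pen]) (auto intro!: exI[of _ 1])
  then have "pen w0 = 0" using pen_nonneg[of w0] by simp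
  then have "\<forall>i\<in>A \<union> B. viol i w0 = 0"
    unfolding pen_def using fin by (subst (asm) sum_nonneg_eq_0_iff) auto
  then have "\<forall>i\<in>A. G i w0 \<le> 0" "\<forall>i\<in>B. G i w0 = 0"
    using disj unfolding viol_def by (metis UnI1 max.cobounded2, metis UnI2 disjoint_iff)
  then have "dist y z \<le> dist y w0" by (rule nearest)
  then have "(norm (z - y))\<^sup>2 \<le> (norm (w0 - y))\<^sup>2" by (simp add: dist_norm norm_minus_commute)
  moreover have "obj w0 \<le> (norm (z - y))\<^sup>2"
  proof (rule LIMSEQ_le_const2[OF lim_obj], intro exI allI impI)
    show "obj (W (r n)) \<le> (norm (z - y))\<^sup>2" for n
      using PW[of "r n"] pen_nonneg[of "W (r n)"] by (smt (verit) mult_nonneg_nonneg of_nat_0_le_iff)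
  qed
  \<comment> \<open>As \<open>w0\<close> is feasible, the first summand of \<open>obj w0\<close>
    alone reaches the upper bound for the whole.\<close>
  ultimately have "(norm (w0 - z))\<^sup>2 \<le> 0" unfolding obj_def by linarith
  then have "w0 = z" by simp
  with lim have "eventually (\<lambda>n. dist (W (r n)) z < \<epsilon>/2) sequentially"
    using \<open>\<epsilon> > 0\<close> unfolding tendsto_iff comp_def by (meson half_gt_zero)
  then obtain n where n: "dist (W (r n)) z < \<epsilon>/2"
    by (auto simp: eventually_sequentially)
  define w where "w = W (r n)"
  define N where "N = real (r n)"
  have viol2: "((\<lambda>w. (viol i w)\<^sup>2) has_derivative (\<lambda>v. 2 * viol i w * (D i w \<bullet> v))) (at w)"
    if i: "i \<in> A \<union> B" for i
  proof (cases "i \<in> A")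
    case True
    \<comment> \<open>The positive part has a kink at 0, but its square does not: there the
      difference quotient is bounded by \<open>\<bar>h\<bar>\<close>.\<close>
    have max2: "((\<lambda>t::real. (max 0 t)\<^sup>2) has_real_derivative 2 * max 0 t) (at t)" for t
    proof -
      consider "t > 0" | "t < 0" | "t = 0" by linarith
      then show ?thesis
      proof cases
        case 1
        have "((\<lambda>t. t\<^sup>2) has_real_derivative 2 * max 0 t) (at t)"
          using 1 by (auto intro!: derivative_eq_intros)
        then show ?thesis
          by (rule has_field_derivative_transform_within_open[of _ _ _ "{0<..}"]) (use 1 in auto)
      next
        case 2
        have "((\<lambda>t. 0) has_real_derivative 2 * max 0 t) (at t)"
          using 2 by (auto intro!: derivative_eq_intros)
        then show ?thesis
          by (rule has_field_derivative_transform_within_open[of _ _ _ "{..<0}"]) (use 2 in auto)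
      next
        case 3
        have "(\<lambda>h::real. (max 0 h)\<^sup>2 / h) \<midarrow>0\<rightarrow> 0"
        proof (rule Lim_null_comparison)
          show "\<forall>\<^sub>F h in at 0. norm ((max 0 h)\<^sup>2 / h) \<le> \<bar>h::real\<bar>"
            by (rule always_eventually) (auto simp: max_def power2_eq_square)
        qed (auto intro!: tendsto_eq_intros)
        then show ?thesis using 3 by (simp add: DERIV_def)
      qed
    qed
    have "((\<lambda>w. (max 0 (G i w))\<^sup>2) has_derivative (\<lambda>v. (D i w \<bullet> v) * (2 * max 0 (G i w)))) (at w)"
      using has_derivative_compose[OF deriv[OF i, of w] max2[of "G i w", unfolded has_field_derivative_def]]
      by (simp add: mult.commute)
    then show ?thesis using True by (simp add: viol_def mult.commute)
  next
    case False
    have "((\<lambda>w. G i w * G i w) has_derivative (\<lambda>v. G i w * (D i w \<bullet> v) + (D i w \<bullet> v) * G i w)) (at w)"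
      by (rule has_derivative_mult[OF deriv[OF i] deriv[OF i]])
    then show ?thesis using False by (simp add: viol_def power2_eq_square algebra_simps)
  qed
  have norm2: "((\<lambda>w. (norm (w - u))\<^sup>2) has_derivative (\<lambda>v. 2 * ((w - u) \<bullet> v))) (at w)" for u
  proof -
    have "((\<lambda>w. w - u) has_derivative (\<lambda>v. v)) (at w)"
      by (auto intro!: derivative_eq_intros)
    from has_derivative_inner[OF this this] show ?thesis
      by (simp add: power2_norm_eq_inner inner_commute)
  qed
  have dP: "(P (r n) has_derivative (\<lambda>v. 2 * ((w - y) \<bullet> v) + 2 * ((w - z) \<bullet> v)
      + N * (\<Sum>i\<in>A \<union> B. 2 * viol i w * (D i w \<bullet> v)))) (at w)"
    unfolding P_def obj_def pen_def N_def
    by (intro has_derivative_add has_derivative_mult_right has_derivative_sum viol2 norm2)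
  have "(\<lambda>v. 2 * ((w - y) \<bullet> v) + 2 * ((w - z) \<bullet> v)
      + N * (\<Sum>i\<in>A \<union> B. 2 * viol i w * (D i w \<bullet> v))) = (\<lambda>v. 0)"
  proof (rule has_derivative_local_min[OF dP])
    have "eventually (\<lambda>u. u \<in> ball z (\<epsilon>/2)) (at w)"
      using n by (intro eventually_at_in_open') (auto simp: w_def dist_commute)
    then show "\<forall>\<^sub>F u in at w. P (r n) w \<le> P (r n) u"
      by eventually_elim (auto simp: w_def intro!: Wmin)
  qed
  then have eq: "2 * ((w - y) \<bullet> v) + 2 * ((w - z) \<bullet> v)
      + N * (\<Sum>i\<in>A \<union> B. 2 * viol i w * (D i w \<bullet> v)) = 0" for v
    by meson
  \<comment> \<open>The factor 2 from all the squares cancels, which leaves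
    \<open>N * viol i w\<close> as the multiplier.\<close>
  have "((\<Sum>i\<in>A \<union> B. (N * viol i w) *\<^sub>R D i w) - ((y - w) + (z - w))) \<bullet> v = 0" for v
  proof -
    have "(\<Sum>i\<in>A \<union> B. (N * viol i w) *\<^sub>R D i w) \<bullet> v = N * (\<Sum>i\<in>A \<union> B. viol i w * (D i w \<bullet> v))"
      by (simp add: inner_sum_left sum_distrib_left mult.assoc)
    moreover have "(\<Sum>i\<in>A \<union> B. 2 * viol i w * (D i w \<bullet> v)) = 2 * (\<Sum>i\<in>A \<union> B. viol i w * (D i w \<bullet> v))"
      by (simp add: sum_distrib_left mult.assoc)
    ultimately show ?thesis using eq[of v] by (simp add: inner_diff_left inner_add_left)
  qed
  then have "(\<Sum>i\<in>A \<union> B. (N * viol i w) *\<^sub>R D i w) = (y - w) + (z - w)"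
    by (metis inner_eq_zero_iff right_minus_eq)
  moreover have "dist w z < \<epsilon>" using n \<open>\<epsilon> > 0\<close> by (simp add: w_def)
  ultimately show thesis
    by (intro that[of w "\<lambda>i. N * viol i w"]) (auto simp: viol_def N_def max_def split: if_splits)
qed

section \<open>Multiplier bounds and conic combinations\<close>

lemma finite_family_convergent_subseq:
  fixes c :: "nat \<Rightarrow> 'i \<Rightarrow> real"
  assumes "finite A" "\<And>i. i \<in> A \<Longrightarrow> bounded (range (\<lambda>n. c n i))"
  shows "\<exists>r l. strict_mono (r :: nat \<Rightarrow> nat) \<and> (\<forall>i\<in>A. (\<lambda>n. c (r n) i) \<longlonglongrightarrow> l i)"
  using assms
proof (induction A rule: finite_induct)
  case empty
  then show ?case using strict_mono_id by blast
next
  case (insert a A)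
  then obtain r l where r: "strict_mono (r :: nat \<Rightarrow> nat)" "\<forall>i\<in>A. (\<lambda>n. c (r n) i) \<longlonglongrightarrow> l i"
    by blast
  have "bounded (range (\<lambda>n. c (r n) a))"
    using insert.prems[of a] by (auto intro: bounded_subset)
  then obtain la r' where r': "strict_mono (r' :: nat \<Rightarrow> nat)" "((\<lambda>n. c (r n) a) \<circ> r') \<longlonglongrightarrow> la"
    using bounded_imp_convergent_subsequence by blast
  have "(\<lambda>n. c ((r \<circ> r') n) i) \<longlonglongrightarrow> (l(a := la)) i" if "i \<in> insert a A" for i
    using that insert.hyps r'(2) LIMSEQ_subseq_LIMSEQ[OF _ r'(1), of "\<lambda>n. c (r n) i"] r(2)
    by (auto simp: comp_def)
  then show ?case using strict_mono_o[OF r(1) r'(1)] by blast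
qed

text \<open>A compactness argument: if no constants worked, ever worse counterexamples, scaled to
  total weight one, would have a limit, and that limit would be a nontrivial dependency at
  \<open>q0\<close> with nonnegative coefficients on \<open>K\<close>.\<close>

lemma uniform_multiplier_bound:
  fixes v :: "'a::metric_space \<Rightarrow> 'i \<Rightarrow> 'v::real_normed_vector"
  assumes fin: "finite K" "finite L"
    and cont: "\<And>i. i \<in> K \<union> L \<Longrightarrow> isCont (\<lambda>q. v q i) q0"
    and indep: "\<not> pos_lin_dep K (v q0) L (v q0)"
  shows "\<exists>M>0. \<exists>\<delta>>0. \<forall>q \<alpha> \<beta>. dist q q0 < \<delta> \<and> (\<forall>i\<in>K. \<alpha> i \<ge> 0) \<longrightarrow>
    (\<Sum>i\<in>K. \<bar>\<alpha> i\<bar>) + (\<Sum>i\<in>L. \<bar>\<beta> i\<bar>) \<le> M * norm ((\<Sum>i\<in>K. \<alpha> i *\<^sub>R v q i) + (\<Sum>i\<in>L. \<beta> i *\<^sub>R v q i))"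
proof (rule ccontr)
  assume neg: "\<not> ?thesis"
  define bad where "bad n q \<alpha> \<beta> \<longleftrightarrow> dist q q0 < 1 / real (Suc n) \<and> (\<forall>i\<in>K. \<alpha> i \<ge> 0) \<and>
     (\<Sum>i\<in>K. \<bar>\<alpha> i\<bar>) + (\<Sum>i\<in>L. \<bar>\<beta> i\<bar>)
       > real (Suc n) * norm ((\<Sum>i\<in>K. \<alpha> i *\<^sub>R v q i) + (\<Sum>i\<in>L. \<beta> i *\<^sub>R v q i))"
    for n q \<alpha> \<beta>
  have "\<exists>q \<alpha> \<beta>. bad n q \<alpha> \<beta>" for n
  proof (rule ccontr)
    assume "\<not> ?thesis"
    then have "\<forall>q \<alpha> \<beta>. dist q q0 < 1 / real (Suc n) \<and> (\<forall>i\<in>K. \<alpha> i \<ge> 0) \<longrightarrow>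
      (\<Sum>i\<in>K. \<bar>\<alpha> i\<bar>) + (\<Sum>i\<in>L. \<bar>\<beta> i\<bar>)
        \<le> real (Suc n) * norm ((\<Sum>i\<in>K. \<alpha> i *\<^sub>R v q i) + (\<Sum>i\<in>L. \<beta> i *\<^sub>R v q i))"
      unfolding bad_def not_ex by (meson not_less)
    moreover have "real (Suc n) > 0" "1 / real (Suc n) > 0" by simp_all
    ultimately show False using neg by blast
  qed
  then obtain q \<alpha> \<beta> where bad: "\<And>n. bad n (q n) (\<alpha> n) (\<beta> n)"
    by metis
  have q: "dist (q n) q0 < 1 / real (Suc n)"
    and \<alpha>: "i \<in> K \<Longrightarrow> \<alpha> n i \<ge> 0"
    and big: "(\<Sum>i\<in>K. \<bar>\<alpha> n i\<bar>) + (\<Sum>i\<in>L. \<bar>\<beta> n i\<bar>)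
      > real (Suc n) * norm ((\<Sum>i\<in>K. \<alpha> n i *\<^sub>R v (q n) i) + (\<Sum>i\<in>L. \<beta> n i *\<^sub>R v (q n) i))" for n i
    using bad[of n] unfolding bad_def by blast+
  define s where "s n = (\<Sum>i\<in>K. \<bar>\<alpha> n i\<bar>) + (\<Sum>i\<in>L. \<bar>\<beta> n i\<bar>)" for n
  \<comment> \<open>The strict inequality in \<open>big\<close> has a nonnegative right side, so the
    scaling is legitimate.\<close>
  have s: "s n > 0" for n
    using big[of n] unfolding s_def by (smt (verit) mult_nonneg_nonneg norm_ge_zero of_nat_0_le_iff)
  define a where "a n i = \<alpha> n i / s n" for n i
  define b where "b n i = \<beta> n i / s n" for n i
  have sum1: "(\<Sum>i\<in>K. \<bar>a n i\<bar>) + (\<Sum>i\<in>L. \<bar>b n i\<bar>) = 1" for n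
    using s[of n] unfolding a_def b_def abs_divide sum_divide_distrib[symmetric] add_divide_distrib[symmetric]
    by (simp add: s_def)
  have a_le: "\<bar>a n i\<bar> \<le> 1" if "i \<in> K" for n i
  proof -
    have "\<bar>a n i\<bar> \<le> (\<Sum>i\<in>K. \<bar>a n i\<bar>)" using that fin(1) by (intro member_le_sum) auto
    moreover have "(\<Sum>i\<in>L. \<bar>b n i\<bar>) \<ge> 0" by (simp add: sum_nonneg)
    ultimately show ?thesis using sum1[of n] by linarith
  qed
  have b_le: "\<bar>b n i\<bar> \<le> 1" if "i \<in> L" for n i
  proof -
    have "\<bar>b n i\<bar> \<le> (\<Sum>i\<in>L. \<bar>b n i\<bar>)" using that fin(2) by (intro member_le_sum) auto
    moreover have "(\<Sum>i\<in>K. \<bar>a n i\<bar>) \<ge> 0" by (simp add: sum_nonneg)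
    ultimately show ?thesis using sum1[of n] by linarith
  qed
  obtain r1 a' where r1: "strict_mono (r1 :: nat \<Rightarrow> nat)" and a': "\<And>i. i \<in> K \<Longrightarrow> (\<lambda>n. a (r1 n) i) \<longlonglongrightarrow> a' i"
    using finite_family_convergent_subseq[OF fin(1), of a] a_le by (force simp: bounded_iff)
  obtain r2 b' where r2: "strict_mono (r2 :: nat \<Rightarrow> nat)" and b': "\<And>i. i \<in> L \<Longrightarrow> (\<lambda>n. b (r1 (r2 n)) i) \<longlonglongrightarrow> b' i"
    using finite_family_convergent_subseq[OF fin(2), of "\<lambda>n. b (r1 n)"] b_le by (force simp: bounded_iff)
  define r where "r = r1 \<circ> r2"
  have r: "strict_mono r" unfolding r_def by (rule strict_mono_o[OF r1 r2])
  have la: "(\<lambda>n. a (r n) i) \<longlonglongrightarrow> a' i" if "i \<in> K" for i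
    using LIMSEQ_subseq_LIMSEQ[OF a'[OF that] r2] by (simp add: r_def comp_def)
  have lb: "(\<lambda>n. b (r n) i) \<longlonglongrightarrow> b' i" if "i \<in> L" for i
    using b'[OF that] by (simp add: r_def)
  have "q \<longlonglongrightarrow> q0"
  proof (rule metric_tendsto_imp_tendsto[OF LIMSEQ_inverse_real_of_nat])
    show "\<forall>\<^sub>F n in sequentially. dist (q n) q0 \<le> dist (inverse (real (Suc n))) 0"
      using q by (intro always_eventually allI) (simp add: less_imp_le inverse_eq_divide del: of_nat_Suc)
  qed
  then have "(\<lambda>n. q (r n)) \<longlonglongrightarrow> q0"
    using LIMSEQ_subseq_LIMSEQ[OF _ r, of q] by (simp add: comp_def)
  then have lv: "(\<lambda>n. v (q (r n)) i) \<longlonglongrightarrow> v q0 i" if "i \<in> K \<union> L" for i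
    using isCont_tendsto_compose[OF cont[OF that]] by blast
  define R where "R n = (\<Sum>i\<in>K. a n i *\<^sub>R v (q n) i) + (\<Sum>i\<in>L. b n i *\<^sub>R v (q n) i)" for n
  have R: "norm (R n) \<le> inverse (real (Suc n))" for n
  proof -
    define T where "T = (\<Sum>i\<in>K. \<alpha> n i *\<^sub>R v (q n) i) + (\<Sum>i\<in>L. \<beta> n i *\<^sub>R v (q n) i)"
    have "R n = inverse (s n) *\<^sub>R T"
      unfolding R_def T_def a_def b_def scaleR_add_right scaleR_sum_right
      by (simp add: divide_inverse mult.commute)
    moreover have "real (Suc n) * norm T < s n" using big[of n] by (simp only: s_def T_def)
    ultimately show ?thesis using s[of n] by (simp add: field_simps del: of_nat_Suc)
  qed
  have "R \<longlonglongrightarrow> 0"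
    by (rule Lim_null_comparison[OF _ LIMSEQ_inverse_real_of_nat]) (use R in auto)
  then have "(\<lambda>n. R (r n)) \<longlonglongrightarrow> 0"
    using LIMSEQ_subseq_LIMSEQ[OF _ r, of R] by (simp add: comp_def)
  moreover have "(\<lambda>n. R (r n)) \<longlonglongrightarrow> (\<Sum>i\<in>K. a' i *\<^sub>R v q0 i) + (\<Sum>i\<in>L. b' i *\<^sub>R v q0 i)"
    unfolding R_def by (intro tendsto_intros la lb lv) auto
  ultimately have zero: "(\<Sum>i\<in>K. a' i *\<^sub>R v q0 i) + (\<Sum>i\<in>L. b' i *\<^sub>R v q0 i) = 0"
    using LIMSEQ_unique by blast
  \<comment> \<open>The total weight one survives the limit, so the limiting coefficients are not
    all zero.\<close>
  have "(\<lambda>n. (\<Sum>i\<in>K. \<bar>a (r n) i\<bar>) + (\<Sum>i\<in>L. \<bar>b (r n) i\<bar>)) \<longlonglongrightarrow> (\<Sum>i\<in>K. \<bar>a' i\<bar>) + (\<Sum>i\<in>L. \<bar>b' i\<bar>)"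
    by (intro tendsto_intros la lb)
  then have "(\<Sum>i\<in>K. \<bar>a' i\<bar>) + (\<Sum>i\<in>L. \<bar>b' i\<bar>) = 1"
    unfolding sum1 using LIMSEQ_unique tendsto_const by blast
  then have "(\<exists>i\<in>K. a' i \<noteq> 0) \<or> (\<exists>i\<in>L. b' i \<noteq> 0)"
    by (metis (no_types, lifting) abs_zero add.right_neutral sum.neutral zero_neq_one)
  moreover have "a' i \<ge> 0" if "i \<in> K" for i
    using LIMSEQ_le_const[OF la[OF that], of 0] \<alpha>[OF that] s by (simp add: a_def less_imp_le)
  ultimately show False using indep zero unfolding pos_lin_dep_def by blast
qed

text \<open>A repeated vector makes a family dependent, through the coefficients 1 and -1. An
  independent family is therefore injective, and its image is an independent set of
  \<open>card L\<close> vectors.\<close>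

lemma dim_span_of_not_lin_dep_fam:
  fixes v :: "'i \<Rightarrow> 'v::euclidean_space"
  assumes "finite L" "\<not> lin_dep_fam L v"
  shows "dim (span (v ` L)) = card L"
proof -
  have inj: "inj_on v L"
  proof (rule inj_onI, rule ccontr)
    fix i j assume ij: "i \<in> L" "j \<in> L" "v i = v j" "i \<noteq> j"
    define c where "c k = (if k = i then 1 else if k = j then -1 else (0::real))" for k
    have "(\<Sum>k\<in>L. c k *\<^sub>R v k) = (\<Sum>k\<in>{i, j}. c k *\<^sub>R v k)"
      using ij assms(1) by (intro sum.mono_neutral_right) (auto simp: c_def)
    also have "\<dots> = 0" using ij by (simp add: c_def)
    finally have "lin_dep_fam L v" unfolding lin_dep_fam_def using ij(1) by (auto simp: c_def intro!: exI[of _ c])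
    with assms show False by simp
  qed
  moreover have "independent (v ` L)"
  proof
    assume "dependent (v ` L)"
    then obtain u where u: "\<exists>x\<in>v ` L. u x \<noteq> 0" "(\<Sum>x\<in>v ` L. u x *\<^sub>R x) = 0"
      using dependent_finite[of "v ` L"] assms(1) by auto
    then have "(\<Sum>i\<in>L. u (v i) *\<^sub>R v i) = 0" by (simp add: sum.reindex[OF inj])
    then have "lin_dep_fam L v" unfolding lin_dep_fam_def using u(1) by (intro exI[of _ "u \<circ> v"]) auto
    with assms show False by simp
  qed
  ultimately show ?thesis by (simp add: dim_eq_card_independent card_image)
qed

text \<open>Caratheodory's reduction with sign constraints on \<open>K\<close> only: every
  dependency of \<open>K \<union> L\<close> involves \<open>K\<close>, because \<open>L\<close> is
  independent, so a multiple of it can be subtracted until an index of \<open>K\<close> drops out.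
  The coefficients on \<open>L\<close> absorb the change.\<close>

lemma conic_caratheodory_modulo_span:
  fixes v :: "'i \<Rightarrow> 'v::real_vector"
  assumes "finite K" "finite L" "K \<inter> L = {}" "\<not> lin_dep_fam L v"
    and "\<And>i. i \<in> K \<Longrightarrow> \<alpha> i \<ge> 0"
  shows "\<exists>K' \<subseteq> K. \<exists>\<alpha>' \<beta>. (\<forall>i\<in>K'. \<alpha>' i \<ge> 0) \<and> \<not> lin_dep_fam (K' \<union> L) v \<and>
    (\<Sum>i\<in>K. \<alpha> i *\<^sub>R v i) = (\<Sum>i\<in>K'. \<alpha>' i *\<^sub>R v i) + (\<Sum>i\<in>L. \<beta> i *\<^sub>R v i)"
  using assms(1,3,5)
proof (induction "card K" arbitrary: K \<alpha> rule: less_induct)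
  case less
  show ?case
  proof (cases "lin_dep_fam (K \<union> L) v")
    case False
    then show ?thesis using less.prems by (intro exI[of _ K] conjI exI[of _ \<alpha>] exI[of _ "\<lambda>_. 0"]) auto
  next
    case True
    then obtain c where c: "\<exists>i\<in>K \<union> L. c i \<noteq> 0" "(\<Sum>i\<in>K \<union> L. c i *\<^sub>R v i) = 0"
      unfolding lin_dep_fam_def by blast
    have split: "(\<Sum>i\<in>K. c i *\<^sub>R v i) + (\<Sum>i\<in>L. c i *\<^sub>R v i) = 0"
      using c(2) less.prems assms(2) by (simp add: sum.union_disjoint)
    have "\<exists>i\<in>K. c i \<noteq> 0"
    proof (rule ccontr)
      assume "\<not> ?thesis"
      with split c(1) assms(4) show False unfolding lin_dep_fam_def by auto
    qed
    \<comment> \<open>The sign is chosen so that some coefficient on \<open>K\<close> is positive;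
      the ratio test below then ranges over a nonempty set.\<close>
    moreover define e where "e = (if \<exists>i\<in>K. c i > 0 then c else (\<lambda>i. - c i))"
    ultimately have "\<exists>i\<in>K. e i > 0" by (auto simp: e_def not_less) (metis order_le_less)
    have e0: "(\<Sum>i\<in>K. e i *\<^sub>R v i) + (\<Sum>i\<in>L. e i *\<^sub>R v i) = 0"
    proof (cases "\<exists>i\<in>K. c i > 0")
      case True
      then have "e = c" by (simp add: e_def)
      with split show ?thesis by simp
    next
      case False
      then have "e = (\<lambda>i. - c i)" unfolding e_def by argo
      then have "(\<Sum>i\<in>K. e i *\<^sub>R v i) + (\<Sum>i\<in>L. e i *\<^sub>R v i)
        = - ((\<Sum>i\<in>K. c i *\<^sub>R v i) + (\<Sum>i\<in>L. c i *\<^sub>R v i))"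
        by (simp add: sum_negf)
      with split show ?thesis by simp
    qed
    define T where "T = {i \<in> K. e i > 0}"
    have T: "finite T" "T \<noteq> {}" using less.prems \<open>\<exists>i\<in>K. e i > 0\<close> by (auto simp: T_def)
    \<comment> \<open>The smallest ratio: it keeps all coefficients on \<open>K\<close> nonnegative
      and annihilates the one at an index attaining it.\<close>
    define t where "t = Min ((\<lambda>i. \<alpha> i / e i) ` T)"
    have "t \<in> (\<lambda>i. \<alpha> i / e i) ` T" unfolding t_def using T by (intro Min_in) auto
    then obtain k where k: "k \<in> K" "e k > 0" "t = \<alpha> k / e k" by (auto simp: T_def)
    have t0: "t \<ge> 0" using k less.prems(3)[of k] by simp
    have t_le: "t \<le> \<alpha> i / e i" if "i \<in> K" "e i > 0" for i
      unfolding t_def using T that by (intro Min_le) (auto simp: T_def)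
    define \<gamma> where "\<gamma> i = \<alpha> i - t * e i" for i
    have \<gamma>: "\<gamma> i \<ge> 0" if "i \<in> K" for i
    proof (cases "e i > 0")
      case True
      then show ?thesis using t_le[OF that] by (simp add: \<gamma>_def field_simps)
    next
      case False
      then have "t * e i \<le> 0" using t0 by (simp add: mult_nonneg_nonpos)
      then show ?thesis using less.prems(3)[OF that] by (simp add: \<gamma>_def)
    qed
    have "\<gamma> k = 0" using k by (simp add: \<gamma>_def)
    have "(\<Sum>i\<in>K. \<alpha> i *\<^sub>R v i) = (\<Sum>i\<in>K. \<gamma> i *\<^sub>R v i) + t *\<^sub>R (\<Sum>i\<in>K. e i *\<^sub>R v i)"
      unfolding \<gamma>_def by (simp add: scaleR_sum_right sum.distrib[symmetric] algebra_simps)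
    also have "(\<Sum>i\<in>K. e i *\<^sub>R v i) = - (\<Sum>i\<in>L. e i *\<^sub>R v i)" using e0 by (simp add: eq_neg_iff_add_eq_0)
    also have "(\<Sum>i\<in>K. \<gamma> i *\<^sub>R v i) = (\<Sum>i\<in>K - {k}. \<gamma> i *\<^sub>R v i)"
      using k \<open>\<gamma> k = 0\<close> less.prems by (simp add: sum.remove)
    finally have step: "(\<Sum>i\<in>K. \<alpha> i *\<^sub>R v i) = (\<Sum>i\<in>K - {k}. \<gamma> i *\<^sub>R v i) + (\<Sum>i\<in>L. (- t * e i) *\<^sub>R v i)"
      by (simp add: scaleR_sum_right sum_negf)
    have card_less: "card (K - {k}) < card K"
      using less.prems(1) k(1) by (rule card_Diff1_less)
    have "\<exists>K' \<subseteq> K - {k}. \<exists>\<alpha>' \<beta>. (\<forall>i\<in>K'. \<alpha>' i \<ge> 0) \<and> \<not> lin_dep_fam (K' \<union> L) v \<and>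
      (\<Sum>i\<in>K - {k}. \<gamma> i *\<^sub>R v i) = (\<Sum>i\<in>K'. \<alpha>' i *\<^sub>R v i) + (\<Sum>i\<in>L. \<beta> i *\<^sub>R v i)"
      using less.prems \<gamma> by (intro less.hyps[OF card_less]) auto
    then obtain K' \<alpha>' \<beta> where K': "K' \<subseteq> K - {k}" "\<forall>i\<in>K'. \<alpha>' i \<ge> 0" "\<not> lin_dep_fam (K' \<union> L) v"
      "(\<Sum>i\<in>K - {k}. \<gamma> i *\<^sub>R v i) = (\<Sum>i\<in>K'. \<alpha>' i *\<^sub>R v i) + (\<Sum>i\<in>L. \<beta> i *\<^sub>R v i)" by blast
    have "(\<Sum>i\<in>K. \<alpha> i *\<^sub>R v i) = (\<Sum>i\<in>K'. \<alpha>' i *\<^sub>R v i) + (\<Sum>i\<in>L. (\<beta> i - t * e i) *\<^sub>R v i)"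
      unfolding step K'(4) by (simp add: algebra_simps sum_subtractf sum_negf)
    then show ?thesis using K' by (intro exI[of _ K'] conjI exI[of _ \<alpha>'] exI[of _ "\<lambda>i. \<beta> i - t * e i"]) auto
  qed
qed

section \<open>The local error bound\<close>

lemma common_radius:
  fixes P :: "'i \<Rightarrow> real \<Rightarrow> bool"
  assumes "finite I" "\<And>i. i \<in> I \<Longrightarrow> \<exists>\<delta>>0. P i \<delta>"
    and "\<And>i \<delta> \<delta>'. i \<in> I \<Longrightarrow> P i \<delta> \<Longrightarrow> 0 < \<delta>' \<Longrightarrow> \<delta>' \<le> \<delta> \<Longrightarrow> P i \<delta>'"
  shows "\<exists>\<delta>>0. \<forall>i\<in>I. P i \<delta>"
proof -
  obtain d where d: "\<And>i. i \<in> I \<Longrightarrow> d i > 0 \<and> P i (d i)" using assms(2) by metis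
  \<comment> \<open>The element 1 covers an empty index set.\<close>
  define \<delta> where "\<delta> = Min (insert 1 (d ` I))"
  have "\<delta> > 0" unfolding \<delta>_def using assms(1) d by (subst Min_gr_iff) auto
  moreover have "\<delta> \<le> d i" if "i \<in> I" for i
    unfolding \<delta>_def using assms(1) that by (intro Min_le) auto
  ultimately show ?thesis using assms(3) d by blast
qed

text \<open>The coefficients are indexed by \<open>L\<close> and not by vectors, so \<open>v\<close>
  may repeat values. Such combinations form a subspace containing the generators.\<close>

lemma span_image_representation:
  fixes v :: "'i \<Rightarrow> 'v::real_vector"
  assumes "finite L" "u \<in> span (v ` L)"
  obtains \<beta> where "u = (\<Sum>i\<in>L. \<beta> i *\<^sub>R v i)"
proof -
  define V where "V = {u. \<exists>\<beta>. u = (\<Sum>i\<in>L. \<beta> i *\<^sub>R v i)}"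
  have "subspace V"
  proof (rule subspaceI)
    show "0 \<in> V" unfolding V_def by (auto intro: exI[of _ "\<lambda>_. 0"])
    show "a + b \<in> V" if ab: "a \<in> V" "b \<in> V" for a b
    proof -
      obtain \<beta> \<gamma> where "a = (\<Sum>i\<in>L. \<beta> i *\<^sub>R v i)" "b = (\<Sum>i\<in>L. \<gamma> i *\<^sub>R v i)"
        using ab unfolding V_def by blast
      then have "a + b = (\<Sum>i\<in>L. (\<beta> i + \<gamma> i) *\<^sub>R v i)"
        by (simp add: scaleR_add_left sum.distrib)
      then show ?thesis unfolding V_def by (intro CollectI exI)
    qed
    show "c *\<^sub>R a \<in> V" if a: "a \<in> V" for c a
    proof -
      obtain \<beta> where "a = (\<Sum>i\<in>L. \<beta> i *\<^sub>R v i)" using a unfolding V_def by blast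
      then have "c *\<^sub>R a = (\<Sum>i\<in>L. (c * \<beta> i) *\<^sub>R v i)" by (simp add: scaleR_sum_right)
      then show ?thesis unfolding V_def by (intro CollectI exI)
    qed
  qed
  moreover have "v ` L \<subseteq> V"
  proof
    fix a assume "a \<in> v ` L"
    then obtain j where j: "j \<in> L" "a = v j" by blast
    have "(\<Sum>i\<in>L. (if i = j then 1 else 0) *\<^sub>R v i) = (\<Sum>i\<in>L. if i = j then v i else 0)"
      by (intro sum.cong) auto
    also have "\<dots> = a" using j assms(1) by simp
    finally show "a \<in> V" unfolding V_def by (intro CollectI exI) (rule sym)
  qed
  ultimately have "u \<in> V" using span_minimal assms(2) by blast
  then show thesis using that unfolding V_def by blast
qed

lemma C1_fun_isCont_fst_snd:
  assumes "C1_fun (\<lambda>z. G (fst z) (snd z))"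
  shows "isCont (\<lambda>z. grad_y G (fst z) (snd z)) q" "isCont (\<lambda>z. G (fst z) (snd z)) q"
  using C1_fun_continuous_grad_y[OF assms] C1_fun_continuous[OF assms]
  unfolding continuous_on_eq_continuous_at[OF open_UNIV] by blast+

lemma dist_Pair_le: "dist (a, b) (c, d) \<le> dist a c + dist b d"
  unfolding dist_Pair_Pair by (rule sqrt_sum_squares_le_sum) auto

text \<open>The projection \<open>z\<close> and its closeness to \<open>yh\<close> are hypotheses,
  because the two cases of the theorem secure them by different means: inner semicontinuity in one,
  compactness and convexity in the other.\<close>

lemma local_error_bound:
  fixes f :: "'a::euclidean_space \<Rightarrow> real^'m \<Rightarrow> real"
  assumes C1f: "C1_fun (\<lambda>z. f (fst z) (snd z))"
    and C1h: "\<forall>i\<in>{1..p}. C1_fun (\<lambda>z. h i (fst z) (snd z))"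
    and lp: "l \<le> p"
    and rcpld: "RCPLD_S l p f h (domGam l p h) xb yh"
    and feas: "yh \<in> Gam l p h xb"
  shows "\<exists>C>0. \<exists>\<delta>>0. \<forall>x y z. dist x xb < \<delta> \<and> dist y yh < \<delta> \<and> dist z yh < \<delta> \<and> y \<in> Gam l p h x
    \<and> z \<in> Sol l p f h x \<and> (\<forall>z'\<in>Sol l p f h x. dist y z \<le> dist y z') \<longrightarrow> dist y z \<le> C * (f x y - f x z)"
proof -
  define G where "G = hh f h"
  define v where "v q i = grad_y (G i) (fst q) (snd q)" for q i
  define J where "J = {l+1..p}"
  define \<Omega> where "\<Omega> = domGam l p h"
  define q0 where "q0 = (xb, yh)"
  \<comment> \<open>Index 0 stands for the constraint that \<open>f\<close> not exceed the value
    function; it is an equality at every solution and so always counts as active.\<close>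
  define Act where "Act = {0} \<union> active l h xb yh"
  have G0: "G 0 = f" and Gi: "i > 0 \<Longrightarrow> G i = h i" for i by (simp_all add: G_def hh_def)
  have C1G: "C1_fun (\<lambda>z. G i (fst z) (snd z))" if "i \<le> p" for i
    using that C1f C1h by (cases "i = 0") (auto simp: G0 Gi)
  have fin: "finite J" "finite Act" by (auto simp: J_def Act_def active_def)
  have Act_le: "Act \<subseteq> {0..l}" by (auto simp: Act_def active_def)
  have contv: "isCont (\<lambda>q. v q i) q" if "i \<le> p" for i q
    unfolding v_def using C1_fun_isCont_fst_snd(1)[OF C1G[OF that]] .
  have "xb \<in> \<Omega>" using feas by (auto simp: \<Omega>_def domGam_def)
  have v_pair: "v (x, y) = (\<lambda>i. grad_y (hh f h i) x y)" for x y
    by (simp add: v_def G_def fun_eq_iff)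
  have "\<exists>U L. open U \<and> (xb, yh) \<in> U \<and> L \<subseteq> J \<and> \<not> lin_dep_fam L (v (xb, yh)) \<and>
      span (v (xb, yh) ` L) = span (v (xb, yh) ` J) \<and>
      (\<forall>x y x' y'. (x, y) \<in> U \<and> x \<in> \<Omega> \<and> (x', y') \<in> U \<and> x' \<in> \<Omega> \<longrightarrow>
        rank_fam J (v (x, y)) = rank_fam J (v (x', y'))) \<and>
      (\<forall>K. K \<subseteq> Act \<and> pos_lin_dep K (v (xb, yh)) L (v (xb, yh)) \<longrightarrow>
        (\<forall>x y. (x, y) \<in> U \<and> x \<in> \<Omega> \<longrightarrow> lin_dep_fam (K \<union> L) (v (x, y))))"
    using rcpld unfolding RCPLD_S_def Let_def v_pair J_def \<Omega>_def Act_def .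
  then obtain U L where U: "open U" "q0 \<in> U" and LJ: "L \<subseteq> J"
    and indep0: "\<not> lin_dep_fam L (v q0)" and span0: "span (v q0 ` L) = span (v q0 ` J)"
    and rank: "\<forall>x y x' y'. (x, y) \<in> U \<and> x \<in> \<Omega> \<and> (x', y') \<in> U \<and> x' \<in> \<Omega> \<longrightarrow>
        rank_fam J (v (x, y)) = rank_fam J (v (x', y'))"
    and pld: "\<forall>K. K \<subseteq> Act \<and> pos_lin_dep K (v q0) L (v q0) \<longrightarrow>
        (\<forall>x y. (x, y) \<in> U \<and> x \<in> \<Omega> \<longrightarrow> lin_dep_fam (K \<union> L) (v (x, y)))"
    unfolding q0_def[symmetric] by (elim exE conjE) (rule that)
  have finL: "finite L" using LJ fin(1) finite_subset by blast
  have L_le: "i \<le> p" if "i \<in> L" for i using LJ that by (auto simp: J_def)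
  obtain \<delta>U where \<delta>U: "\<delta>U > 0" "ball q0 \<delta>U \<subseteq> U" using U open_contains_ball by blast

  \<comment> \<open>For an empty \<open>K\<close> positive-linear dependence is plain dependence of
    \<open>L\<close>, so the multiplier bound shows that \<open>L\<close> stays independent near
    \<open>q0\<close>.\<close>
  have "\<not> pos_lin_dep {} (v q0) L (v q0)"
    using indep0 unfolding pos_lin_dep_def lin_dep_fam_def by auto
  with uniform_multiplier_bound[where K = "{}" and L = L and v = v and ?q0.0 = q0] finL contv L_le
  obtain M0 \<delta>0 where "M0 > 0" and \<delta>0: "\<delta>0 > 0"
    and M0: "\<And>q \<beta>. dist q q0 < \<delta>0 \<Longrightarrow> (\<Sum>i\<in>L. \<bar>\<beta> i\<bar>) \<le> M0 * norm (\<Sum>i\<in>L. \<beta> i *\<^sub>R v q i)"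
    by auto
  have indep: "\<not> lin_dep_fam L (v q)" if "dist q q0 < \<delta>0" for q
  proof
    assume "lin_dep_fam L (v q)"
    then obtain c i where c: "i \<in> L" "c i \<noteq> 0" "(\<Sum>i\<in>L. c i *\<^sub>R v q i) = 0"
      unfolding lin_dep_fam_def by blast
    have "\<bar>c i\<bar> \<le> (\<Sum>i\<in>L. \<bar>c i\<bar>)" using c(1) finL by (intro member_le_sum) auto
    with M0[OF that, of c] c show False by simp
  qed
  \<comment> \<open>Near \<open>q0\<close> the family \<open>L\<close> keeps dimension
    \<open>card L\<close>, and by constant rank \<open>J\<close> has no larger one.\<close>
  have span_eq: "span (v (x, w) ` L) = span (v (x, w) ` J)"
    if "dist (x, w) q0 < \<delta>0" "(x, w) \<in> U" "x \<in> \<Omega>" for x w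
  proof (rule dim_eq_span)
    show "v (x, w) ` L \<subseteq> v (x, w) ` J" using LJ by blast
    have "dim (v (x, w) ` J) = dim (v q0 ` J)"
      using rank[rule_format, of x w xb yh] that U(2) \<open>xb \<in> \<Omega>\<close> by (simp add: rank_fam_def q0_def)
    also have "\<dots> = card L"
      using dim_span_of_not_lin_dep_fam[OF finL indep0] unfolding span0 by simp
    also have "\<dots> = dim (v (x, w) ` L)"
      using dim_span_of_not_lin_dep_fam[OF finL indep[OF that(1)]] by simp
    finally show "dim (v (x, w) ` J) \<le> dim (v (x, w) ` L)" by simp
  qed

  \<comment> \<open>Which \<open>K\<close> the reduction yields varies with \<open>x\<close>,
    \<open>y\<close> and \<open>z\<close>; as there are finitely many candidates, one constant and
    one radius serve them all.\<close>
  define \<K> where "\<K> = {K. K \<subseteq> Act \<and> \<not> pos_lin_dep K (v q0) L (v q0)}"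
  have fin\<K>: "finite \<K>" unfolding \<K>_def using fin(2) by simp
  define bd where "bd K M \<delta> \<longleftrightarrow> (\<forall>q \<alpha> \<beta>. dist q q0 < \<delta> \<and> (\<forall>i\<in>K. \<alpha> i \<ge> 0) \<longrightarrow>
    (\<Sum>i\<in>K. \<bar>\<alpha> i\<bar>) + (\<Sum>i\<in>L. \<bar>\<beta> i\<bar>) \<le> M * norm ((\<Sum>i\<in>K. \<alpha> i *\<^sub>R v q i) + (\<Sum>i\<in>L. \<beta> i *\<^sub>R v q i)))"
    for K M \<delta>
  have "\<exists>M>0. \<exists>\<delta>>0. bd K M \<delta>" if "K \<in> \<K>" for K
  proof -
    have "finite K" "\<And>i. i \<in> K \<Longrightarrow> i \<le> p"
      using that fin(2) Act_le lp finite_subset by (auto simp: \<K>_def)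
    then show ?thesis unfolding bd_def
      by (intro uniform_multiplier_bound finL contv) (use that L_le in \<open>auto simp: \<K>_def\<close>)
  qed
  then obtain MK where MK: "\<And>K. K \<in> \<K> \<Longrightarrow> MK K > 0 \<and> (\<exists>\<delta>>0. bd K (MK K) \<delta>)" by metis
  \<comment> \<open>The sum dominates each \<open>MK K\<close>, and the 1 keeps \<open>M\<close>
    positive even if \<open>\<K>\<close> is empty.\<close>
  define M where "M = 1 + sum MK \<K>"
  have M: "M > 0" "\<And>K. K \<in> \<K> \<Longrightarrow> MK K \<le> M"
    unfolding M_def using MK fin\<K> member_le_sum[of _ \<K> MK]
    by (smt (verit, best) sum_nonneg, smt (verit, best) DiffD1)
  have "\<exists>\<delta>>0. \<forall>K\<in>\<K>. bd K M \<delta>"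
  proof (rule common_radius[OF fin\<K>])
    fix K assume K: "K \<in> \<K>"
    then obtain \<delta> where \<delta>: "\<delta> > 0" "bd K (MK K) \<delta>" using MK by blast
    have "bd K M \<delta>" using \<delta>(2) M(2)[OF K] unfolding bd_def
      by (meson mult_right_mono norm_ge_zero order_trans)
    with \<delta> show "\<exists>\<delta>>0. bd K M \<delta>" by blast
  qed (auto simp: bd_def)
  then obtain \<delta>K where \<delta>K: "\<delta>K > 0" "\<And>K. K \<in> \<K> \<Longrightarrow> bd K M \<delta>K" by blast

  \<comment> \<open>With multipliers of total weight at most \<open>2 * M * d\<close>, where
    \<open>d = dist y z\<close>, the linearization error contributes at most
    \<open>d * d / 4\<close>. The lower estimate at the end is \<open>3 / 4\<close> of
    \<open>d * d\<close>, so half of \<open>d * d\<close> is left over and the constant becomes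
    \<open>4 * M\<close>.\<close>
  define \<epsilon> where "\<epsilon> = 1 / (8 * M)"
  have "\<epsilon> > 0" using M by (simp add: \<epsilon>_def)
  define lin where "lin i \<delta> \<longleftrightarrow> (\<forall>x y z w. dist x xb < \<delta> \<and> dist y yh < \<delta> \<and> dist z yh < \<delta> \<and> dist w yh < \<delta> \<longrightarrow>
      \<bar>G i x y - G i x z - v (x, w) i \<bullet> (y - z)\<bar> \<le> \<epsilon> * dist y z)" for i \<delta>
  have "\<exists>\<delta>>0. \<forall>i\<in>{0..p}. lin i \<delta>"
  proof (rule common_radius)
    fix i assume "i \<in> {0..p}"
    then show "\<exists>\<delta>>0. lin i \<delta>"
      unfolding lin_def v_def fst_conv snd_conv
      by (intro C1_fun_linearization C1G \<open>\<epsilon> > 0\<close>) auto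
  qed (auto simp: lin_def)
  then obtain \<delta>L where \<delta>L: "\<delta>L > 0" "\<And>i. i \<le> p \<Longrightarrow> lin i \<delta>L" by auto

  define inact where "inact i \<delta> \<longleftrightarrow> (\<forall>q. dist q q0 < \<delta> \<longrightarrow> h i (fst q) (snd q) < 0)" for i \<delta>
  have "\<exists>\<delta>>0. \<forall>i\<in>{1..l} - Act. inact i \<delta>"
  proof (rule common_radius)
    fix i assume i: "i \<in> {1..l} - Act"
    then have neg: "h i xb yh < 0" using feas by (auto simp: Gam_def Act_def active_def less_le)
    have "isCont (\<lambda>z. h i (fst z) (snd z)) q0"
      using i lp C1h by (intro C1_fun_isCont_fst_snd(2)) auto
    then obtain \<delta> where "\<delta> > 0" and \<delta>: "\<And>q. dist q q0 < \<delta> \<Longrightarrow>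
        dist (h i (fst q) (snd q)) (h i xb yh) < - h i xb yh"
      using neg unfolding continuous_at_eps_delta q0_def by (metis fst_conv neg_0_less_iff_less snd_conv)
    have "inact i \<delta>" unfolding inact_def
    proof (intro allI impI)
      fix q assume "dist q q0 < \<delta>"
      from \<delta>[OF this] show "h i (fst q) (snd q) < 0" by (simp add: dist_real_def)
    qed
    with \<open>\<delta> > 0\<close> show "\<exists>\<delta>>0. inact i \<delta>" by blast
  qed (auto simp: inact_def)
  then obtain \<delta>I where \<delta>I: "\<delta>I > 0" "\<And>i. i \<in> {1..l} - Act \<Longrightarrow> inact i \<delta>I" by blast

  define r where "r = Min {\<delta>U, \<delta>0, \<delta>K, \<delta>L, \<delta>I}"
  have r: "r > 0" "r \<le> \<delta>U" "r \<le> \<delta>0" "r \<le> \<delta>K" "r \<le> \<delta>L" "r \<le> \<delta>I"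
    using \<delta>U \<delta>0 \<delta>K \<delta>L \<delta>I by (auto simp: r_def)

  have "dist y z \<le> 4 * M * (f x y - f x z)"
    if near: "dist x xb < r/4" "dist y yh < r/4" "dist z yh < r/4" and y: "y \<in> Gam l p h x"
      and z: "z \<in> Sol l p f h x" and nearest: "\<forall>z'\<in>Sol l p f h x. dist y z \<le> dist y z'" for x y z
  proof (cases "y = z")
    case True
    then show ?thesis by simp
  next
    case False
    define d where "d = dist y z"
    have d: "d > 0" using False by (simp add: d_def)
    define \<Delta> where "\<Delta> = f x y - f x z"
    have \<Delta>: "\<Delta> \<ge> 0" using y z by (auto simp: \<Delta>_def Sol_def)
    have xO: "x \<in> \<Omega>" using y by (auto simp: \<Omega>_def domGam_def)
    have zG: "z \<in> Gam l p h x" using z by (simp add: Sol_def)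
    \<comment> \<open>Subtracting \<open>f x z\<close>, the optimal value at \<open>x\<close>, turns
      the solution set into the feasible set of the system \<open>Gx\<close>. The gradients in the
      second variable do not change.\<close>
    define Gx where "Gx i w = G i x w - (if i = 0 then f x z else 0)" for i w
    have derivG: "(G i x has_derivative (\<bullet>) (v (x, w) i)) (at w)" if "i \<le> p" for i w
      unfolding v_def fst_conv snd_conv by (rule C1_fun_has_derivative_grad_y[OF C1G[OF that]])
    \<comment> \<open>Staying within \<open>\<eta>\<close> of z keeps inactive inequalities inactive, so that every inequality with a
      nonzero multiplier at w is active at z.\<close>
    have strict: "\<exists>\<eta>>0. \<forall>i\<in>{i\<in>{1..l}. h i x z < 0}. \<forall>w. dist w z < \<eta> \<longrightarrow> h i x w < 0"
    proof (rule common_radius)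
      fix i assume i: "i \<in> {i\<in>{1..l}. h i x z < 0}"
      then have "(h i x has_derivative (\<bullet>) (v (x, z) i)) (at z)" using derivG[of i z] lp by (simp add: Gi)
      then have "isCont (h i x) z" by (rule has_derivative_continuous)
      then obtain \<eta> where "\<eta> > 0" and \<eta>: "\<And>w. dist w z < \<eta> \<Longrightarrow> dist (h i x w) (h i x z) < - h i x z"
        using i unfolding continuous_at_eps_delta by (metis (mono_tags, lifting) mem_Collect_eq neg_0_less_iff_less)
      have "\<forall>w. dist w z < \<eta> \<longrightarrow> h i x w < 0"
      proof (intro allI impI)
        fix w assume "dist w z < \<eta>"
        from \<eta>[OF this] show "h i x w < 0" by (simp add: dist_real_def)
      qed
      with \<open>\<eta> > 0\<close> show "\<exists>\<eta>>0. \<forall>w. dist w z < \<eta> \<longrightarrow> h i x w < 0" by blast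
    qed auto
    then obtain \<eta> where \<eta>: "\<eta> > 0" "\<And>i w. i \<in> {1..l} \<Longrightarrow> h i x z < 0 \<Longrightarrow> dist w z < \<eta> \<Longrightarrow> h i x w < 0"
      by blast
    \<comment> \<open>The three bounds preserve strict inequalities at \<open>z\<close>, make
      \<open>w\<close> negligible against \<open>d\<close>, and keep \<open>(x, w)\<close> within
      \<open>r\<close> of \<open>q0\<close>.\<close>
    define \<rho> where "\<rho> = min \<eta> (min (d / 8) (r / 4))"
    have \<rho>: "\<rho> > 0" using \<eta> d r by (simp add: \<rho>_def)
    have feas_iff: "w \<in> Sol l p f h x"
      if "\<forall>i\<in>{0..l}. Gx i w \<le> 0" "\<forall>i\<in>J. Gx i w = 0" for w
    proof -
      have "h i x w \<le> 0" if "i \<in> {1..l}" for i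
        using \<open>\<forall>i\<in>{0..l}. Gx i w \<le> 0\<close>[rule_format, of i] that by (simp add: Gx_def Gi)
      moreover have "h i x w = 0" if "i \<in> {l+1..p}" for i
        using \<open>\<forall>i\<in>J. Gx i w = 0\<close>[rule_format, of i] that by (simp add: Gx_def Gi J_def)
      moreover have "f x w \<le> f x z"
        using that(1)[rule_format, of 0] by (simp add: Gx_def G0)
      ultimately show ?thesis using z unfolding Sol_def Gam_def by force
    qed
    obtain w \<mu> where w: "dist w z < \<rho>" and \<mu>0: "\<And>i. i \<in> {0..l} \<Longrightarrow> \<mu> i \<ge> 0"
      and \<mu>pos: "\<And>i. i \<in> {0..l} \<Longrightarrow> \<mu> i \<noteq> 0 \<Longrightarrow> Gx i w > 0"
      and kkt: "(\<Sum>i\<in>{0..l} \<union> J. \<mu> i *\<^sub>R v (x, w) i) = (y - w) + (z - w)"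
    proof (rule approximate_multipliers_of_projection[of "{0..l}" J Gx "\<lambda>i w. v (x, w) i" z y \<rho>])
      show "(Gx i has_derivative (\<bullet>) (v (x, w) i)) (at w)" if "i \<in> {0..l} \<union> J" for i w
      proof -
        have "i \<le> p" using that lp by (auto simp: J_def)
        from has_derivative_diff[OF derivG[OF this] has_derivative_const]
        show ?thesis unfolding Gx_def[abs_def] by simp
      qed
      show "\<forall>i\<in>{0..l}. Gx i z \<le> 0" "\<forall>i\<in>J. Gx i z = 0"
        using zG lp by (auto simp: Gx_def G0 Gi Gam_def J_def)
      show "dist y z \<le> dist y w" if "\<forall>i\<in>{0..l}. Gx i w \<le> 0" "\<forall>i\<in>J. Gx i w = 0" for w
        using nearest feas_iff[OF that] by blast
    qed (use \<rho> fin in \<open>auto simp: J_def\<close>)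
    have w_near: "dist w yh < r / 2"
      using dist_triangle[of w yh z] w near(3) by (simp add: \<rho>_def)
    have q_near: "dist (x, w) q0 < r"
      using dist_Pair_le[of x w xb yh] near(1) w_near r(1) by (simp add: q0_def)
    have qU: "(x, w) \<in> U" using q_near r(2) \<delta>U(2) by (auto simp: dist_commute)
    define K0 where "K0 = {i\<in>{0..l}. \<mu> i \<noteq> 0}"
    \<comment> \<open>A nonzero multiplier means violation at \<open>w\<close>, whereas inequalities
      inactive at the reference point remain negative near \<open>q0\<close>.\<close>
    have K0_Act: "K0 \<subseteq> Act"
    proof
      fix i assume i: "i \<in> K0"
      show "i \<in> Act"
      proof (rule ccontr)
        assume nA: "i \<notin> Act"
        then have i1: "i \<in> {1..l} - Act" using i by (auto simp: K0_def Act_def)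
        then have "h i x w < 0" using \<delta>I(2)[OF i1] q_near r(6) by (auto simp: inact_def)
        moreover have "h i x w > 0" using \<mu>pos[of i] i i1 by (auto simp: K0_def Gx_def Gi)
        ultimately show False by simp
      qed
    qed
    have K0_active: "h i x z = 0" if "i \<in> K0" "i > 0" for i
    proof (rule ccontr)
      assume "h i x z \<noteq> 0"
      moreover have il: "i \<in> {1..l}" using that by (auto simp: K0_def)
      ultimately have "h i x z < 0" using zG by (auto simp: Gam_def less_le)
      then have "h i x w < 0" using \<eta>(2)[OF il] w by (simp add: \<rho>_def)
      moreover have "h i x w > 0" using \<mu>pos[of i] that by (auto simp: K0_def Gx_def Gi)
      ultimately show False by simp
    qed
    have "(\<Sum>i\<in>J. \<mu> i *\<^sub>R v (x, w) i) \<in> span (v (x, w) ` J)"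
      by (intro span_sum span_scale span_base) auto
    then have "(\<Sum>i\<in>J. \<mu> i *\<^sub>R v (x, w) i) \<in> span (v (x, w) ` L)"
      using span_eq[OF _ qU xO] q_near r(3) by simp
    then obtain \<beta> where \<beta>: "(\<Sum>i\<in>J. \<mu> i *\<^sub>R v (x, w) i) = (\<Sum>i\<in>L. \<beta> i *\<^sub>R v (x, w) i)"
      using span_image_representation[OF finL] by metis
    have "\<exists>K \<subseteq> K0. \<exists>\<alpha>' \<beta>. (\<forall>i\<in>K. \<alpha>' i \<ge> 0) \<and> \<not> lin_dep_fam (K \<union> L) (v (x, w)) \<and>
      (\<Sum>i\<in>K0. \<mu> i *\<^sub>R v (x, w) i) = (\<Sum>i\<in>K. \<alpha>' i *\<^sub>R v (x, w) i) + (\<Sum>i\<in>L. \<beta> i *\<^sub>R v (x, w) i)"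
      using indep[of "(x, w)"] q_near r(3) finL LJ \<mu>0
      by (intro conic_caratheodory_modulo_span) (auto simp: K0_def J_def)
    then obtain K \<alpha> \<gamma>' where K: "K \<subseteq> K0" and \<alpha>: "\<And>i. i \<in> K \<Longrightarrow> \<alpha> i \<ge> 0"
      and ind: "\<not> lin_dep_fam (K \<union> L) (v (x, w))"
      and rep: "(\<Sum>i\<in>K0. \<mu> i *\<^sub>R v (x, w) i) = (\<Sum>i\<in>K. \<alpha> i *\<^sub>R v (x, w) i) + (\<Sum>i\<in>L. \<gamma>' i *\<^sub>R v (x, w) i)"
      by blast
    define \<gamma> where "\<gamma> i = \<gamma>' i + \<beta> i" for i
    define V where "V = (y - w) + (z - w)"
    have "V = (\<Sum>i\<in>{0..l}. \<mu> i *\<^sub>R v (x, w) i) + (\<Sum>i\<in>J. \<mu> i *\<^sub>R v (x, w) i)"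
      unfolding V_def kkt[symmetric] using fin by (intro sum.union_disjoint) (auto simp: J_def)
    also have "(\<Sum>i\<in>{0..l}. \<mu> i *\<^sub>R v (x, w) i) = (\<Sum>i\<in>K0. \<mu> i *\<^sub>R v (x, w) i)"
      by (intro sum.mono_neutral_right) (auto simp: K0_def)
    finally have V: "V = (\<Sum>i\<in>K. \<alpha> i *\<^sub>R v (x, w) i) + (\<Sum>i\<in>L. \<gamma> i *\<^sub>R v (x, w) i)"
      unfolding rep \<beta> \<gamma>_def by (simp add: scaleR_add_left sum.distrib)
    \<comment> \<open>The contrapositive of the third RCPLD condition: independence at the single
      nearby point \<open>(x, w)\<close> excludes positive-linear dependence at
      \<open>q0\<close>.\<close>
    have "K \<in> \<K>" unfolding \<K>_def using K K0_Act pld qU xO ind by blast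
    define T where "T = (\<Sum>i\<in>K. \<bar>\<alpha> i\<bar>) + (\<Sum>i\<in>L. \<bar>\<gamma> i\<bar>)"
    have T0: "(\<Sum>i\<in>K. \<bar>\<alpha> i\<bar>) \<le> T" by (simp add: T_def sum_nonneg)
    have zw: "norm (z - w) \<le> d / 8" using w by (simp add: \<rho>_def dist_norm norm_minus_commute)
    have Vyz: "V = (y - z) + 2 *\<^sub>R (z - w)" by (simp add: V_def scaleR_2)
    have "norm V \<le> norm (y - z) + norm (2 *\<^sub>R (z - w))" unfolding Vyz by (rule norm_triangle_ineq)
    also have "\<dots> = d + 2 * norm (z - w)" by (simp add: d_def dist_norm)
    also have "\<dots> \<le> 2 * d" using zw d by linarith
    finally have "norm V \<le> 2 * d" .
    then have "M * norm V \<le> M * (2 * d)" using M(1) by (intro mult_left_mono) auto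
    moreover have "T \<le> M * norm V"
      using \<delta>K(2)[OF \<open>K \<in> \<K>\<close>] q_near r(4) \<alpha> unfolding bd_def T_def V by auto
    ultimately have T: "T \<le> 2 * M * d" by linarith
    have lin': "\<bar>G i x y - G i x z - v (x, w) i \<bullet> (y - z)\<bar> \<le> \<epsilon> * d" if "i \<le> p" for i
      using \<delta>L(2)[OF that] near w_near r(1,5) unfolding lin_def d_def by simp
    \<comment> \<open>For \<open>i > 0\<close> the value at \<open>z\<close> is zero and the value
      at \<open>y\<close> is nonpositive, so the increment is at most 0; for \<open>i = 0\<close> it
      is exactly \<open>\<Delta>\<close>.\<close>
    have K_term: "v (x, w) i \<bullet> (y - z) \<le> \<Delta> + \<epsilon> * d" if "i \<in> K" for i
    proof -
      have i: "i \<in> K0" "i \<le> l" using that K by (auto simp: K0_def)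
      have "G i x y - G i x z \<le> \<Delta>"
      proof (cases "i = 0")
        case False
        then have "h i x y \<le> 0" "h i x z = 0" using y i K0_active by (auto simp: Gam_def)
        then show ?thesis using False \<Delta> by (simp add: Gi)
      qed (simp add: G0 \<Delta>_def)
      with lin'[of i] i lp show ?thesis by linarith
    qed
    have L_term: "\<bar>v (x, w) i \<bullet> (y - z)\<bar> \<le> \<epsilon> * d" if "i \<in> L" for i
    proof -
      have "G i x y = 0" "G i x z = 0" "i \<le> p" using that LJ y zG by (auto simp: J_def Gi Gam_def)
      with lin'[of i] show ?thesis by simp
    qed
    have "V \<bullet> (y - z) = (\<Sum>i\<in>K. \<alpha> i * (v (x, w) i \<bullet> (y - z))) + (\<Sum>i\<in>L. \<gamma> i * (v (x, w) i \<bullet> (y - z)))"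
      unfolding V by (simp add: inner_add_left inner_sum_left)
    also have "\<dots> \<le> (\<Sum>i\<in>K. \<bar>\<alpha> i\<bar> * (\<Delta> + \<epsilon> * d)) + (\<Sum>i\<in>L. \<bar>\<gamma> i\<bar> * (\<epsilon> * d))"
    proof (intro add_mono sum_mono)
      show "\<alpha> i * (v (x, w) i \<bullet> (y - z)) \<le> \<bar>\<alpha> i\<bar> * (\<Delta> + \<epsilon> * d)" if "i \<in> K" for i
        using \<alpha>[OF that] K_term[OF that] by (simp add: mult_left_mono)
      show "\<gamma> i * (v (x, w) i \<bullet> (y - z)) \<le> \<bar>\<gamma> i\<bar> * (\<epsilon> * d)" if "i \<in> L" for i
      proof -
        have "\<gamma> i * (v (x, w) i \<bullet> (y - z)) \<le> \<bar>\<gamma> i\<bar> * \<bar>v (x, w) i \<bullet> (y - z)\<bar>"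
          unfolding abs_mult[symmetric] by (rule abs_ge_self)
        also have "\<dots> \<le> \<bar>\<gamma> i\<bar> * (\<epsilon> * d)" using L_term[OF that] by (intro mult_left_mono) auto
        finally show ?thesis .
      qed
    qed
    also have "\<dots> = (\<Sum>i\<in>K. \<bar>\<alpha> i\<bar>) * \<Delta> + T * (\<epsilon> * d)"
      unfolding T_def sum_distrib_right[symmetric] by (simp add: algebra_simps)
    also have "\<dots> \<le> T * \<Delta> + T * (\<epsilon> * d)"
      using T0 \<Delta> by (simp add: mult_right_mono)
    also have "\<dots> \<le> (2 * M * d) * \<Delta> + (2 * M * d) * (\<epsilon> * d)"
      using T \<Delta> \<open>\<epsilon> > 0\<close> d by (intro add_mono mult_right_mono) auto
    also have "\<dots> = d * (2 * M * \<Delta> + d / 4)" using M(1) by (simp add: \<epsilon>_def field_simps)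
    finally have upper: "V \<bullet> (y - z) \<le> d * (2 * M * \<Delta> + d / 4)" .
    have "\<bar>(z - w) \<bullet> (y - z)\<bar> \<le> norm (z - w) * norm (y - z)" by (rule Cauchy_Schwarz_ineq2)
    also have "\<dots> \<le> d / 8 * d" using zw d by (intro mult_mono) (auto simp: d_def dist_norm)
    finally have "\<bar>(z - w) \<bullet> (y - z)\<bar> \<le> d / 8 * d" .
    moreover have "V \<bullet> (y - z) = d * d + 2 * ((z - w) \<bullet> (y - z))"
      unfolding Vyz by (simp add: inner_add_left d_def dist_norm power2_norm_eq_inner[symmetric] power2_eq_square)
    ultimately have "d * (3 / 4 * d) \<le> V \<bullet> (y - z)" by (simp add: abs_le_iff)
    with upper have "d * (3 / 4 * d) \<le> d * (2 * M * \<Delta> + d / 4)" by linarith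
    then have "3 / 4 * d \<le> 2 * M * \<Delta> + d / 4" using d by (simp only: mult_le_cancel_left_pos)
    then show ?thesis by (simp add: d_def \<Delta>_def)
  qed
  moreover have "4 * M > 0" "r / 4 > 0" using M r by simp_all
  ultimately show ?thesis by blast
qed

section \<open>Closedness of solution sets and Lipschitz continuity in the second variable\<close>

lemma closed_Gam:
  assumes "\<And>i. i \<in> {1..p} \<Longrightarrow> continuous_on UNIV (h i x)" "l \<le> p"
  shows "closed (Gam l p h x)"
proof -
  have "Gam l p h x = (\<Inter>i\<in>{1..l}. {y. h i x y \<le> 0}) \<inter> (\<Inter>i\<in>{l+1..p}. {y. h i x y = 0})"
    by (auto simp: Gam_def)
  also have "closed \<dots>"
    using assms by (intro closed_Int closed_INT ballI closed_Collect_le closed_Collect_eq continuous_on_const) auto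
  finally show ?thesis .
qed

lemma closed_Sol:
  assumes "\<And>i. i \<in> {1..p} \<Longrightarrow> continuous_on UNIV (h i x)" "l \<le> p" "continuous_on UNIV (f x)"
  shows "closed (Sol l p f h x)"
proof -
  have "Sol l p f h x = Gam l p h x \<inter> (\<Inter>y'\<in>Gam l p h x. {y. f x y \<le> f x y'})"
    by (auto simp: Sol_def)
  also have "closed \<dots>"
    using assms by (intro closed_Int closed_INT ballI closed_Collect_le closed_Gam continuous_on_const) auto
  finally show ?thesis .
qed

lemma phi_eq_of_Sol: "z \<in> Sol l p f h x \<Longrightarrow> phi l p f h x = ereal (f x z)"
  unfolding phi_def Sol_def by (intro antisym INF_lower2[of z] INF_greatest) auto

lemma C1_fun_continuous_snd:
  fixes G :: "'a::real_normed_vector \<Rightarrow> real^'m \<Rightarrow> real"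
  assumes "C1_fun (\<lambda>z. G (fst z) (snd z))"
  shows "continuous_on UNIV (G x)"
  by (intro continuous_at_imp_continuous_on ballI
      has_derivative_continuous[OF C1_fun_has_derivative_grad_y[OF assms]])

lemma C1_fun_tendsto:
  fixes G :: "'a::real_normed_vector \<Rightarrow> real^'m \<Rightarrow> real"
  assumes "C1_fun (\<lambda>z. G (fst z) (snd z))" "(a \<longlongrightarrow> x) \<F>" "(b \<longlongrightarrow> y) \<F>"
  shows "((\<lambda>k. G (a k) (b k)) \<longlongrightarrow> G x y) \<F>"
  using isCont_tendsto_compose[OF C1_fun_isCont_fst_snd(2)[OF assms(1)] tendsto_Pair[OF assms(2,3)]]
  by simp

lemma C1_fun_lipschitz_snd:
  fixes G :: "'a::real_normed_vector \<Rightarrow> real^'m \<Rightarrow> real"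
  assumes C1: "C1_fun (\<lambda>z. G (fst z) (snd z))"
  shows "\<exists>N>0. \<exists>\<delta>>0. \<forall>x y z. dist x x0 < \<delta> \<and> dist y y0 < \<delta> \<and> dist z y0 < \<delta> \<longrightarrow>
    \<bar>G x y - G x z\<bar> \<le> N * dist y z"
proof -
  obtain d1 where d1: "d1 > 0" "\<And>x y z. dist x x0 < d1 \<Longrightarrow> dist y y0 < d1 \<Longrightarrow> dist z y0 < d1 \<Longrightarrow>
      \<bar>G x y - G x z - grad_y G x y0 \<bullet> (y - z)\<bar> \<le> 1 * dist y z"
    using C1_fun_linearization[OF C1, of 1 x0 y0] by auto
  obtain d2 where d2: "d2 > 0"
    "\<And>q. dist q (x0, y0) < d2 \<Longrightarrow> dist (grad_y G (fst q) (snd q)) (grad_y G x0 y0) < 1"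
    using C1_fun_isCont_fst_snd(1)[OF C1, of "(x0, y0)"] unfolding continuous_at_eps_delta
    by (metis fst_conv snd_conv zero_less_one)
  \<comment> \<open>One unit pays for the variation of the gradient between \<open>x\<close> and
    \<open>x0\<close>, the other for the linearization error.\<close>
  define N where "N = norm (grad_y G x0 y0) + 2"
  have "\<bar>G x y - G x z\<bar> \<le> N * dist y z"
    if x: "dist x x0 < min d1 d2" and y: "dist y y0 < min d1 d2" and z: "dist z y0 < min d1 d2" for x y z
  proof -
    have "dist (x, y0) (x0, y0) < d2" using dist_Pair_le[of x y0 x0 y0] x by simp
    from d2(2)[OF this] have "norm (grad_y G x y0) \<le> norm (grad_y G x0 y0) + 1"
      using norm_triangle_sub[of "grad_y G x y0" "grad_y G x0 y0"] by (simp add: dist_norm)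
    then have "norm (grad_y G x y0) * norm (y - z) \<le> (norm (grad_y G x0 y0) + 1) * norm (y - z)"
      by (rule mult_right_mono) simp
    then have "\<bar>grad_y G x y0 \<bullet> (y - z)\<bar> \<le> (norm (grad_y G x0 y0) + 1) * dist y z"
      unfolding dist_norm using Cauchy_Schwarz_ineq2 order_trans by blast
    moreover have "\<bar>G x y - G x z - grad_y G x y0 \<bullet> (y - z)\<bar> \<le> 1 * dist y z"
      using x y z by (intro d1(2)) auto
    ultimately show ?thesis unfolding N_def by (simp add: algebra_simps)
  qed
  moreover have "N > 0" unfolding N_def by (simp add: add_nonneg_pos)
  ultimately show ?thesis using d1(1) d2(1) by (metis min_less_iff_conj)
qed

section \<open>From the error bound to partial calmness\<close>

lemma frequently_of_eventually_subseq:
  assumes "strict_mono s" "\<forall>\<^sub>F k in sequentially. P (s k)"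
  shows "\<exists>\<^sub>F k in sequentially. P k"
  unfolding frequently_def
proof
  assume "\<forall>\<^sub>F k in sequentially. \<not> P k"
  with assms(1) have "\<forall>\<^sub>F k in sequentially. \<not> P (s k)" by (rule eventually_subseq)
  with assms(2) have "\<forall>\<^sub>F k in sequentially. False" by eventually_elim simp
  then show False by simp
qed

text \<open>In the convex case the projections accumulate at some solution \<open>yh\<close> that
  depends on the subsequence, and the constant is the one belonging to \<open>yh\<close>. The bound
  therefore holds only frequently, which suffices against a sequence of counterexamples.\<close>

lemma error_bound_along_sequence:
  fixes f :: "'a::euclidean_space \<Rightarrow> real^'m \<Rightarrow> real"
  assumes C1f: "C1_fun (\<lambda>z. f (fst z) (snd z))"
    and C1h: "\<forall>i\<in>{1..p}. C1_fun (\<lambda>z. h i (fst z) (snd z))"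
    and lp: "l \<le> p"
    and yb: "yb \<in> Sol l p f h xb"
    and xs: "xs \<longlonglongrightarrow> xb" and ys: "ys \<longlonglongrightarrow> yb" and feas: "\<And>k. ys k \<in> Gam l p h (xs k)"
    and cases:
      "((\<forall>x. convex_on UNIV (f x) \<and> (\<forall>i\<in>{1..l}. convex_on UNIV (h i x))
              \<and> (\<forall>i\<in>{l+1..p}. \<exists>a b. \<forall>y. h i x y = a \<bullet> y + b))
         \<and> locally_bounded_at (Gam l p h) xb
         \<and> (\<forall>y\<in>Sol l p f h xb. RCPLD_S l p f h (domGam l p h) xb y))
       \<or> (inner_semicont_wrt (Sol l p f h) (domGam l p h) xb yb
          \<and> RCPLD_S l p f h (domGam l p h) xb yb)"
  shows "\<exists>C>0. \<exists>\<^sub>F k in sequentially. \<exists>z\<in>Sol l p f h (xs k).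
    dist (ys k) z \<le> C * (f (xs k) (ys k) - f (xs k) z)"
proof -
  have cont_h: "continuous_on UNIV (h i x)" if "i \<in> {1..p}" for i x
    using C1h that by (intro C1_fun_continuous_snd) blast
  have cont_f: "continuous_on UNIV (f x)" for x by (rule C1_fun_continuous_snd[OF C1f])
  have clG: "closed (Gam l p h x)" and clS: "closed (Sol l p f h x)" for x
    by (intro closed_Gam closed_Sol cont_h lp cont_f; assumption)+
  have dom: "xs k \<in> domGam l p h" for k using feas[of k] by (auto simp: domGam_def)
  have nearest: "\<exists>z\<in>Sol l p f h x. \<forall>z'\<in>Sol l p f h x. dist y z \<le> dist y z'"
    if "Sol l p f h x \<noteq> {}" for x y
    using distance_attains_inf[OF clS that] by metis
  have feas_yb: "yb \<in> Gam l p h xb" using yb by (simp add: Sol_def)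
  from cases show ?thesis
  proof (elim disjE conjE)
    assume inner: "inner_semicont_wrt (Sol l p f h) (domGam l p h) xb yb"
      and "RCPLD_S l p f h (domGam l p h) xb yb"
    from local_error_bound[OF C1f C1h lp this(2) feas_yb] obtain C \<delta> where C: "C > 0" "\<delta> > 0"
      and bound: "\<And>x y z. dist x xb < \<delta> \<Longrightarrow> dist y yb < \<delta> \<Longrightarrow> dist z yb < \<delta> \<Longrightarrow> y \<in> Gam l p h x
        \<Longrightarrow> z \<in> Sol l p f h x \<Longrightarrow> (\<forall>z'\<in>Sol l p f h x. dist y z \<le> dist y z') \<Longrightarrow> dist y z \<le> C * (f x y - f x z)"
      by blast
    obtain ws where ws: "ws \<longlonglongrightarrow> yb" "\<forall>\<^sub>F k in sequentially. ws k \<in> Sol l p f h (xs k)"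
      using inner dom xs unfolding inner_semicont_wrt_def by blast
    have "\<forall>\<^sub>F k in sequentially. dist (xs k) xb < \<delta>" "\<forall>\<^sub>F k in sequentially. dist (ys k) yb < \<delta> / 4"
      "\<forall>\<^sub>F k in sequentially. dist (ws k) yb < \<delta> / 4"
      using tendstoD[OF xs, of \<delta>] tendstoD[OF ys, of "\<delta> / 4"] tendstoD[OF ws(1), of "\<delta> / 4"] C(2)
      by simp_all
    then have "\<forall>\<^sub>F k in sequentially. \<exists>z\<in>Sol l p f h (xs k). dist (ys k) z \<le> C * (f (xs k) (ys k) - f (xs k) z)"
      using ws(2)
    proof eventually_elim
      case (elim k)
      from nearest[of "xs k" "ys k"] elim(4) obtain z where z: "z \<in> Sol l p f h (xs k)"
        and nz: "\<forall>z'\<in>Sol l p f h (xs k). dist (ys k) z \<le> dist (ys k) z'" by blast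
      \<comment> \<open>The projection is no farther from \<open>ys k\<close> than
        \<open>ws k\<close> is, hence within \<open>\<delta> / 2\<close> of it and within
        \<open>3 * \<delta> / 4\<close> of \<open>yb\<close>.\<close>
      have "dist (ys k) z \<le> dist (ys k) (ws k)" using nz elim(4) by blast
      moreover have "dist (ys k) (ws k) \<le> dist (ys k) yb + dist (ws k) yb" by (rule dist_triangle2)
      moreover have "dist z yb \<le> dist (ys k) z + dist (ys k) yb" by (rule dist_triangle3)
      ultimately have "dist z yb < \<delta>" using elim C(2) by linarith
      moreover have "dist (ys k) yb < \<delta>" using elim(2) C(2) by linarith
      ultimately have "dist (ys k) z \<le> C * (f (xs k) (ys k) - f (xs k) z)"
        using elim(1) feas[of k] z nz by (intro bound)
      with z show ?case by blast
    qed
    then show ?thesis using C(1) eventually_frequently[OF sequentially_bot] by blast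
  next
    assume conv: "\<forall>x. convex_on UNIV (f x) \<and> (\<forall>i\<in>{1..l}. convex_on UNIV (h i x))
              \<and> (\<forall>i\<in>{l+1..p}. \<exists>a b. \<forall>y. h i x y = a \<bullet> y + b)"
      and bdd: "locally_bounded_at (Gam l p h) xb"
      and rcpld: "\<forall>y\<in>Sol l p f h xb. RCPLD_S l p f h (domGam l p h) xb y"
    from bdd obtain B V where B: "bounded B"
      and V: "open V" "xb \<in> V" "\<And>x. x \<in> V \<Longrightarrow> Gam l p h x \<subseteq> B"
      unfolding locally_bounded_at_def by blast
    obtain N where N: "\<And>k. k \<ge> N \<Longrightarrow> xs k \<in> V"
      using topological_tendstoD[OF xs V(1,2)] unfolding eventually_sequentially by blast
    \<comment> \<open>Local boundedness makes the feasible sets compact once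
      \<open>k \<ge> N\<close>, so minimizers and then projections exist.\<close>
    have "\<exists>z. k \<ge> N \<longrightarrow> z \<in> Sol l p f h (xs k) \<and> (\<forall>z'\<in>Sol l p f h (xs k). dist (ys k) z \<le> dist (ys k) z')" for k
    proof (cases "k \<ge> N")
      case True
      have "bounded (Gam l p h (xs k))" by (rule bounded_subset[OF B V(3)[OF N[OF True]]])
      then have "compact (Gam l p h (xs k))" using clG by (simp add: compact_eq_bounded_closed)
      moreover have "Gam l p h (xs k) \<noteq> {}" using feas[of k] by blast
      moreover have "continuous_on (Gam l p h (xs k)) (f (xs k))"
        using cont_f continuous_on_subset by blast
      ultimately obtain z where "z \<in> Gam l p h (xs k)" "\<forall>y\<in>Gam l p h (xs k). f (xs k) z \<le> f (xs k) y"
        using continuous_attains_inf by blast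
      then have "Sol l p f h (xs k) \<noteq> {}" by (auto simp: Sol_def)
      with nearest[of "xs k" "ys k"] show ?thesis by blast
    qed simp
    then obtain zs where zs: "\<And>k. k \<ge> N \<Longrightarrow> zs k \<in> Sol l p f h (xs k)"
      and zs_nearest: "\<And>k. k \<ge> N \<Longrightarrow> \<forall>z'\<in>Sol l p f h (xs k). dist (ys k) (zs k) \<le> dist (ys k) z'"
      by metis
    have zsG: "zs k \<in> Gam l p h (xs k)" if "k \<ge> N" for k using zs[OF that] by (simp add: Sol_def)
    have "bounded (range (\<lambda>k. zs (k + N)))"
      using zsG V(3)[OF N] by (intro bounded_subset[OF B]) (auto, metis le_add2 subsetD)
    then obtain yh r where r: "strict_mono (r :: nat \<Rightarrow> nat)" "((\<lambda>k. zs (k + N)) \<circ> r) \<longlonglongrightarrow> yh"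
      using bounded_imp_convergent_subsequence by blast
    define s where "s k = r k + N" for k
    have s: "strict_mono s" using r(1) by (simp add: s_def strict_mono_def)
    have sN: "s k \<ge> N" for k by (simp add: s_def)
    have zs_lim: "(\<lambda>k. zs (s k)) \<longlonglongrightarrow> yh" using r(2) by (simp add: s_def comp_def)
    have xs_lim: "(\<lambda>k. xs (s k)) \<longlonglongrightarrow> xb" and ys_lim: "(\<lambda>k. ys (s k)) \<longlonglongrightarrow> yb"
      using LIMSEQ_subseq_LIMSEQ[OF xs s] LIMSEQ_subseq_LIMSEQ[OF ys s] by (simp_all add: comp_def)
    have yhG: "yh \<in> Gam l p h xb"
    proof -
      have lim: "(\<lambda>k. h i (xs (s k)) (zs (s k))) \<longlonglongrightarrow> h i xb yh" if "i \<in> {1..p}" for i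
        by (rule C1_fun_tendsto[OF C1h[rule_format, OF that] xs_lim zs_lim])
      have "h i xb yh \<le> 0" if "i \<in> {1..l}" for i
        using that lp zsG[OF sN] by (intro LIMSEQ_le_const2[OF lim] exI[of _ 0]) (simp_all add: Gam_def)
      moreover have "h i xb yh = 0" if "i \<in> {l+1..p}" for i
        using that lim[of i] zsG[OF sN] by (simp add: Gam_def LIMSEQ_const_iff)
      ultimately show ?thesis by (simp add: Gam_def)
    qed
    \<comment> \<open>Comparing \<open>zs\<close> with \<open>ys\<close>, which tends to the
      solution \<open>yb\<close>, gives optimality of \<open>yh\<close> without any continuity of
      the value function.\<close>
    have "f xb yh \<le> f xb yb"
    proof (rule LIMSEQ_le[OF C1_fun_tendsto[OF C1f xs_lim zs_lim] C1_fun_tendsto[OF C1f xs_lim ys_lim]])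
      show "\<exists>n0. \<forall>k\<ge>n0. f (xs (s k)) (zs (s k)) \<le> f (xs (s k)) (ys (s k))"
        using zs[OF sN] feas unfolding Sol_def by blast
    qed
    then have yh: "yh \<in> Sol l p f h xb" using yb yhG by (fastforce simp: Sol_def)
    from local_error_bound[OF C1f C1h lp _ yhG] rcpld yh obtain C \<delta> where C: "C > 0" "\<delta> > 0"
      and bound: "\<And>x y z. dist x xb < \<delta> \<Longrightarrow> dist y yh < \<delta> \<Longrightarrow> dist z yh < \<delta> \<Longrightarrow> y \<in> Gam l p h x
        \<Longrightarrow> z \<in> Sol l p f h x \<Longrightarrow> (\<forall>z'\<in>Sol l p f h x. dist y z \<le> dist y z') \<Longrightarrow> dist y z \<le> C * (f x y - f x z)"
      by blast
    obtain D where D: "\<And>a b. a \<in> B \<Longrightarrow> b \<in> B \<Longrightarrow> dist a b \<le> D"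
      using B bounded_two_points by metis
    define D' where "D' = max D 1"
    \<comment> \<open>One \<open>t\<close> for all \<open>k\<close>: it brings the points of the
      segment within \<open>\<delta> / 2\<close> of \<open>z\<close>, and \<open>z\<close> itself
      ends up within \<open>\<delta> / 2\<close> of \<open>yh\<close>.\<close>
    define t where "t = min 1 (\<delta> / (2 * D'))"
    have t: "0 < t" "t \<le> 1" "t * D' \<le> \<delta> / 2"
      using C(2) by (auto simp: t_def D'_def min_def field_simps)
    have "\<forall>\<^sub>F k in sequentially. dist (xs (s k)) xb < \<delta>" "\<forall>\<^sub>F k in sequentially. dist (zs (s k)) yh < \<delta> / 2"
      using tendstoD[OF xs_lim, of \<delta>] tendstoD[OF zs_lim, of "\<delta> / 2"] C(2) by simp_all
    then have "\<forall>\<^sub>F k in sequentially. \<exists>z\<in>Sol l p f h (xs (s k)).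
        dist (ys (s k)) z \<le> C * (f (xs (s k)) (ys (s k)) - f (xs (s k)) z)"
    proof eventually_elim
      case (elim k)
      define x y z where "x = xs (s k)" and "y = ys (s k)" and "z = zs (s k)"
      have yG: "y \<in> Gam l p h x" and zG: "z \<in> Gam l p h x" and zS: "z \<in> Sol l p f h x"
        and nz: "\<And>z'. z' \<in> Sol l p f h x \<Longrightarrow> dist y z \<le> dist y z'"
        using feas zsG[OF sN] zs[OF sN] zs_nearest[OF sN] by (auto simp: x_def y_def z_def)
      \<comment> \<open>The limit of the projections may differ from \<open>yb\<close>. By convexity the segment from z to y stays
        feasible, every point of it still projects to z, and the estimate is homogeneous along it.\<close>
      define y' where "y' = (1 - t) *\<^sub>R z + t *\<^sub>R y"
      have convD: "g y' \<le> (1 - t) * g z + t * g y" if "convex_on UNIV g" for g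
        unfolding y'_def using t by (intro convex_onD[OF that]) auto
      have y'G: "y' \<in> Gam l p h x"
      proof -
        have "h i x y' \<le> 0" if "i \<in> {1..l}" for i
        proof -
          have "h i x y' \<le> (1 - t) * h i x z + t * h i x y" using conv that by (intro convD) blast
          also have "\<dots> \<le> 0" using yG zG that t
            by (intro add_nonpos_nonpos mult_nonneg_nonpos) (auto simp: Gam_def)
          finally show ?thesis .
        qed
        moreover have "h i x y' = 0" if i: "i \<in> {l+1..p}" for i
        proof -
          obtain a b where ab: "\<And>y. h i x y = a \<bullet> y + b" using conv i by blast
          have "h i x y' = (1 - t) * h i x z + t * h i x y"
            unfolding ab y'_def by (simp add: inner_add_right algebra_simps)
          then show ?thesis using yG zG i by (simp add: Gam_def)
        qed
        ultimately show ?thesis by (simp add: Gam_def)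
      qed
      have "y' - z = t *\<^sub>R (y - z)" "y - y' = (1 - t) *\<^sub>R (y - z)"
        by (simp_all add: y'_def algebra_simps)
      then have dy'z: "dist y' z = t * dist y z" and dyy': "dist y y' = (1 - t) * dist y z"
        using t by (simp_all add: dist_norm)
      have "dist y z \<le> D'"
        using D[of y z] V(3)[OF N[OF sN]] yG zG unfolding x_def D'_def by fastforce
      then have "dist y' z \<le> \<delta> / 2" using t dy'z by (smt (verit) mult_left_mono)
      moreover have zyh: "dist z yh < \<delta> / 2" using elim(2) by (simp add: z_def)
      ultimately have "dist y' yh < \<delta>" using dist_triangle[of y' yh z] by linarith
      moreover have "dist z yh < \<delta>" using zyh C(2) by linarith
      moreover have "\<forall>z'\<in>Sol l p f h x. dist y' z \<le> dist y' z'"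
      proof
        fix z' assume "z' \<in> Sol l p f h x"
        then have "dist y z \<le> dist y y' + dist y' z'" using nz dist_triangle[of y z' y'] by force
        then show "dist y' z \<le> dist y' z'" unfolding dy'z dyy' by (simp add: algebra_simps)
      qed
      ultimately have "dist y' z \<le> C * (f x y' - f x z)"
        using elim(1) y'G zS by (intro bound) (simp_all add: x_def)
      also have "\<dots> \<le> C * (t * (f x y - f x z))"
        using convD[of "f x"] conv C(1) by (intro mult_left_mono) (auto simp: algebra_simps)
      finally have "t * dist y z \<le> t * (C * (f x y - f x z))" by (simp add: dy'z algebra_simps)
      then have "dist y z \<le> C * (f x y - f x z)" using t(1) by simp
      with zS show ?case unfolding x_def y_def z_def by blast
    qed
    then show ?thesis using C(1) frequently_of_eventually_subseq[OF s] by meson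
  qed
qed

theorem theorem4p19:
  fixes F f :: "real^'n \<Rightarrow> real^'m \<Rightarrow> real"
    and h :: "nat \<Rightarrow> real^'n \<Rightarrow> real^'m \<Rightarrow> real"
    and l p :: nat
    and X :: "(real^'n) set"
    and xb :: "real^'n" and yb :: "real^'m"
  assumes lp: "l \<le> p"
    and C1F: "C1_fun (\<lambda>z. F (fst z) (snd z))"
    and C1f: "C1_fun (\<lambda>z. f (fst z) (snd z))"
    and C1h: "\<forall>i\<in>{1..p}. C1_fun (\<lambda>z. h i (fst z) (snd z))"
    and Xcl: "closed X"
    and locmin: "local_min_BPP l p F f h X xb yb"
    and cases:
      "((\<forall>x. convex_on UNIV (f x) \<and> (\<forall>i\<in>{1..l}. convex_on UNIV (h i x))
              \<and> (\<forall>i\<in>{l+1..p}. \<exists>a b. \<forall>y. h i x y = a \<bullet> y + b))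
         \<and> locally_bounded_at (Gam l p h) xb
         \<and> (\<forall>y\<in>Sol l p f h xb. RCPLD_S l p f h (domGam l p h) xb y))
       \<or> (inner_semicont_wrt (Sol l p f h) (domGam l p h) xb yb
          \<and> RCPLD_S l p f h (domGam l p h) xb yb)"
  shows "partially_calm l p F f h X xb yb"
proof (rule ccontr)
  assume neg: "\<not> ?thesis"
  obtain V where yb: "yb \<in> Sol l p f h xb" and V: "open V" "(xb, yb) \<in> V"
    and min: "\<And>x y. (x, y) \<in> V \<Longrightarrow> x \<in> X \<Longrightarrow> y \<in> Sol l p f h x \<Longrightarrow> F xb yb \<le> F x y"
    using locmin unfolding local_min_BPP_def by blast
  \<comment> \<open>The penalty weight and the inverse radius are both \<open>Suc n\<close>, so the
    violating triples converge to the reference point while the weight outgrows every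
    constant.\<close>
  define bad where "bad n x y u \<longleftrightarrow> (x, y, u) \<in> ball (xb, yb, 0) (inverse (real (Suc n))) \<and> x \<in> X \<and>
    ereal (f x y) - phi l p f h x \<le> ereal u \<and> y \<in> Gam l p h x \<and> F x y - F xb yb + real (Suc n) * \<bar>u\<bar> < 0"
    for n x y u
  have "\<exists>x y u. bad n x y u" for n
  proof (rule ccontr)
    assume no: "\<not> ?thesis"
    have "open (ball (xb, yb, 0::real) (inverse (real (Suc n))))" "real (Suc n) > 0"
      "(xb, yb, 0) \<in> ball (xb, yb, 0::real) (inverse (real (Suc n)))"
      by simp_all
    moreover have "\<forall>x y u. (x, y, u) \<in> ball (xb, yb, 0) (inverse (real (Suc n))) \<and> x \<in> X \<and>
      ereal (f x y) - phi l p f h x \<le> ereal u \<and> y \<in> Gam l p h x \<longrightarrow> F x y - F xb yb + real (Suc n) * \<bar>u\<bar> \<ge> 0"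
      using no unfolding bad_def not_less[symmetric] by blast
    ultimately have "partially_calm l p F f h X xb yb" unfolding partially_calm_def by blast
    with neg show False by contradiction
  qed
  then obtain xs ys us where bad: "\<And>n. bad n (xs n) (ys n) (us n)" by metis
  have feas: "ys n \<in> Gam l p h (xs n)" and val: "ereal (f (xs n) (ys n)) - phi l p f h (xs n) \<le> ereal (us n)"
    and xsX: "xs n \<in> X" and drop: "F (xs n) (ys n) - F xb yb + real (Suc n) * \<bar>us n\<bar> < 0" for n
    using bad[of n] by (simp_all add: bad_def)
  have "(\<lambda>n. (xs n, ys n, us n)) \<longlonglongrightarrow> (xb, yb, 0)"
  proof (rule metric_tendsto_imp_tendsto[OF LIMSEQ_inverse_real_of_nat])
    have "dist (xs n, ys n, us n) (xb, yb, 0) \<le> dist (inverse (real (Suc n))) 0" for n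
      using bad[of n] by (simp add: bad_def dist_commute less_imp_le)
    then show "\<forall>\<^sub>F n in sequentially. dist (xs n, ys n, us n) (xb, yb, 0) \<le> dist (inverse (real (Suc n))) 0"
      by simp
  qed
  from tendsto_fst[OF this] tendsto_fst[OF tendsto_snd[OF this]] tendsto_snd[OF tendsto_snd[OF this]]
  have xs: "xs \<longlonglongrightarrow> xb" and ys: "ys \<longlonglongrightarrow> yb" and us: "us \<longlonglongrightarrow> 0" by simp_all
  obtain C where C: "C > 0" and freq: "\<exists>\<^sub>F k in sequentially. \<exists>z\<in>Sol l p f h (xs k).
      dist (ys k) z \<le> C * (f (xs k) (ys k) - f (xs k) z)"
    using error_bound_along_sequence[OF C1f C1h lp yb xs ys feas cases] by blast
  obtain N \<delta> where N: "N > 0" "\<delta> > 0" and lip: "\<And>x y z. dist x xb < \<delta> \<Longrightarrow> dist y yb < \<delta> \<Longrightarrow> dist z yb < \<delta> \<Longrightarrow>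
      \<bar>F x y - F x z\<bar> \<le> N * dist y z"
    using C1_fun_lipschitz_snd[OF C1F] by blast
  obtain e where e: "e > 0" "ball (xb, yb) e \<subseteq> V" using V open_contains_ball by blast
  \<comment> \<open>The factor one half arises because the distance of pairs is bounded by the sum
    of the distances of the components.\<close>
  define \<rho> where "\<rho> = min \<delta> (e / 2)"
  have \<rho>: "\<rho> > 0" using N e by (simp add: \<rho>_def)
  have "(\<lambda>k. C * \<bar>us k\<bar>) \<longlonglongrightarrow> 0" using us by (auto intro!: tendsto_eq_intros)
  then have "\<forall>\<^sub>F k in sequentially. C * \<bar>us k\<bar> < \<rho> / 2" using \<rho> by (intro order_tendstoD) auto
  moreover have "\<forall>\<^sub>F k in sequentially. dist (xs k) xb < \<rho>" "\<forall>\<^sub>F k in sequentially. dist (ys k) yb < \<rho> / 2"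
    using tendstoD[OF xs, of \<rho>] tendstoD[OF ys, of "\<rho> / 2"] \<rho> by simp_all
  moreover have "\<forall>\<^sub>F k in sequentially. N * C \<le> real k"
    using eventually_ge_at_top[of "nat \<lceil>N * C\<rceil>"] by eventually_elim (simp add: nat_ceiling_le_eq)
  ultimately have "\<forall>\<^sub>F k in sequentially. \<not> (\<exists>z\<in>Sol l p f h (xs k).
      dist (ys k) z \<le> C * (f (xs k) (ys k) - f (xs k) z))"
  proof eventually_elim
    case (elim k)
    show ?case
    proof
      assume "\<exists>z\<in>Sol l p f h (xs k). dist (ys k) z \<le> C * (f (xs k) (ys k) - f (xs k) z)"
      then obtain z where z: "z \<in> Sol l p f h (xs k)"
        and dz: "dist (ys k) z \<le> C * (f (xs k) (ys k) - f (xs k) z)" by blast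
      \<comment> \<open>Existence of the solution \<open>z\<close> makes the value finite, so the
        extended-real inequality becomes a real one.\<close>
      have "f (xs k) (ys k) - f (xs k) z \<le> us k"
        using val[of k] unfolding phi_eq_of_Sol[OF z] by simp
      then have "C * (f (xs k) (ys k) - f (xs k) z) \<le> C * \<bar>us k\<bar>" using C by (intro mult_left_mono) auto
      with dz have dz': "dist (ys k) z \<le> C * \<bar>us k\<bar>" by linarith
      then have "dist (ys k) z < \<rho> / 2" using elim(1) by linarith
      then have zy: "dist z yb < \<rho>" using dist_triangle3[of z yb "ys k"] elim(3) by linarith
      have "dist (xs k, z) (xb, yb) < e"
        using dist_Pair_le[of "xs k" z xb yb] zy elim(2) by (simp add: \<rho>_def)
      then have "(xs k, z) \<in> V" using e(2) by (auto simp: dist_commute)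
      \<comment> \<open>Only the second component was repaired, so \<open>xs k\<close> is still in
        \<open>X\<close> and local minimality applies to \<open>(xs k, z)\<close>. Going back to
        \<open>ys k\<close> costs at most \<open>N * C * \<bar>us k\<bar>\<close>, which the weight
        \<open>Suc k\<close> exceeds.\<close>
      then have "F xb yb \<le> F (xs k) z" using min xsX z by blast
      also have "F (xs k) z \<le> F (xs k) (ys k) + N * dist (ys k) z"
        using lip[of "xs k" "ys k" z] elim(2,3) zy \<rho> by (simp add: \<rho>_def)
      also have "N * dist (ys k) z \<le> N * C * \<bar>us k\<bar>"
        using dz' N(1) by (simp add: mult.assoc)
      also have "\<dots> \<le> real (Suc k) * \<bar>us k\<bar>" using elim(4) by (intro mult_right_mono) auto
      finally show False using drop[of k] by linarith
    qed
  qed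
  with freq show False unfolding frequently_def by blast
qed

end
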